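(* Let $B$ be a one-dimensional standard Brownian motion, fix $t>0$, and let $A_s=\int_0^s e^{2B_u}\,du$. Then \[ \left\{\frac{1}{A_s}+\frac{e^{2B_t}}{A_t}-\frac{1}{A_t}\right\}_{0<s\le t}\ \stackrel{(d)}{=}\ \left\{\frac{1}{A_s}\right\}_{0<s\le t}. \]
   Context: $\stackrel{(d)}{=}$ denotes equality in law of processes. *)

theory Defs
  imports "HOL-Probability.Probability"
begin

definition standard_brownian_motion :: "'a measure \<Rightarrow> (real \<Rightarrow> 'a \<Rightarrow> real) \<Rightarrow> bool" where
  "standard_brownian_motion M B \<longleftrightarrow>
     prob_space M \<and>
     (\<forall>t\<ge>0. B t \<in> borel_measurable M) \<and>
     (\<forall>\<omega>\<in>space M. B 0 \<omega> = 0 \<and> continuous_on {0..} (\<lambda>t. B t \<omega>)) \<and>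
     (\<forall>s t. 0 \<le> s \<and> s < t \<longrightarrow>
        distributed M lborel (\<lambda>\<omega>. B t \<omega> - B s \<omega>)
          (\<lambda>x. ennreal (normal_density 0 (sqrt (t - s)) x))) \<and>
     (\<forall>(n::nat) (ts::nat \<Rightarrow> real). 0 \<le> ts 0 \<and> (\<forall>i<n. ts i \<le> ts (Suc i)) \<longrightarrow>
        prob_space.indep_vars M (\<lambda>_. borel) (\<lambda>i \<omega>. B (ts (Suc i)) \<omega> - B (ts i) \<omega>) {..<n})"

definition process_law :: "'a measure \<Rightarrow> real set \<Rightarrow> (real \<Rightarrow> 'a \<Rightarrow> real) \<Rightarrow> (real \<Rightarrow> real) measure" where
  "process_law M T X = distr M (Pi\<^sub>M T (\<lambda>_. borel)) (\<lambda>\<omega>. \<lambda>s\<in>T. X s \<omega>)"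

definition expfun :: "(real \<Rightarrow> 'a \<Rightarrow> real) \<Rightarrow> real \<Rightarrow> 'a \<Rightarrow> real" where
  "expfun B s \<omega> = integral {0..s} (\<lambda>u. exp (2 * B u \<omega>))"

end

(* Write Z_s = exp (- B_s) A_s. Since d (1 / A_s) = - ds / Z_s^2, the process 1 / A on (0, t] is
   determined by the path of Z and by 1 / A_t = exp (- B_t) / Z_t, and the transformation in question
   keeps the path of Z and replaces B_t by - B_t. So the claim is that, given the path of Z up to
   time t, the law of B_t is symmetric.

   For a suitable random walk this is exact: let the steps have density proportional to
   exp (- cosh x / h), and discretise A by A_k = h * sum_{j<k} exp (X_j + X_{j+1}), Z_k = exp (- X_k) A_k.
   Then, given Z_1, ..., Z_n, the density of X_n is proportional to exp (- cosh x / Z_n), by induction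
   on n through a one-dimensional change of variables. The density of n = t / h such steps with
   respect to n Gaussian steps of variance h tends to 1 in L^2 as h tends to 0, so the Brownian motion
   sampled on a grid is symmetric up to an error that vanishes in the limit; the discretised A
   converges to A along each path. *)

theory Submission
  imports Defs
begin

text \<open>The weight cosh fits the recursion Z_{k+1} = Z_k exp (- d) + h exp x for a step d from
  position x. With exp (- cosh x / z) as the weight of the position and exp (- cosh d / h) as that
  of the step, the total exponent splits into a function of the two ratios plus cosh (x + d) /
  Z_{k+1}, so an even weight at the end point reproduces itself. Since cosh x = 1 + x^2 / 2 + O(x^4)
  near 0, such a step is to leading order Gaussian with variance h.

  The comparison with Gaussian steps is made in L^2 for a reason. The density of a single step
  deviates from 1 by order h, and adding up n = t / h such errors in L^1 would leave an error of
  order t. The normalised densities of the single steps are independent with mean 1 and variance of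
  order h^2, so their product has second moment at most (1 + O(h^2))^n, which tends to 1.\<close>

section \<open>Change of variables for one step of the cosh walk\<close>

lemma nn_integral_exp_substitution:
  fixes f :: "real \<Rightarrow> ennreal"
  assumes [measurable]: "f \<in> borel_measurable borel" and c: "c > 0"
  shows "(\<integral>\<^sup>+x. f (c * exp x) \<partial>lborel) =
         (\<integral>\<^sup>+z. f z * ennreal (1 / z) * indicator {0<..} z \<partial>lborel)"
proof -
  let ?g = "\<lambda>z. f z * ennreal (1 / z)"
  \<comment> \<open>On a compact interval this is the classical substitution z = c * exp x.
    \<open>Suc n\<close> instead of \<open>n\<close> keeps the interval nondegenerate for n = 0.
    Monotone convergence then exhausts the line and the half-line.\<close>
  have sub: "(\<integral>\<^sup>+z. ?g z * indicator {c * exp (- real (Suc n))..c * exp (real (Suc n))} z \<partial>lborel) =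
      (\<integral>\<^sup>+x. f (c * exp x) * indicator {- real (Suc n)..real (Suc n)} x \<partial>lborel)" for n
  proof -
    have "(\<integral>\<^sup>+z. ?g z * indicator {c * exp (- real (Suc n))..c * exp (real (Suc n))} z \<partial>lborel) =
      (\<integral>\<^sup>+x. ?g (c * exp x) * ennreal (c * exp x) * indicator {- real (Suc n)..real (Suc n)} x \<partial>lborel)"
      by (rule nn_integral_substitution_aux)
        (use c in \<open>auto intro!: derivative_eq_intros continuous_intros\<close>)
    also have "\<dots> = (\<integral>\<^sup>+x. f (c * exp x) * indicator {- real (Suc n)..real (Suc n)} x \<partial>lborel)"
    proof (rule nn_integral_cong)
      fix x :: real
      have "ennreal (1 / (c * exp x)) * ennreal (c * exp x) = 1"
        using c by (simp add: ennreal_mult[symmetric])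
      then show "?g (c * exp x) * ennreal (c * exp x) * indicator {- real (Suc n)..real (Suc n)} x
          = f (c * exp x) * indicator {- real (Suc n)..real (Suc n)} x"
        by (simp add: mult.assoc)
    qed
    finally show ?thesis .
  qed
  have inc1: "incseq (\<lambda>n. {- real (Suc n)..real (Suc n)})"
    by (auto simp: incseq_def)
  have inc2: "incseq (\<lambda>n. {c * exp (- real (Suc n))..c * exp (real (Suc n))})"
  proof (rule incseq_SucI)
    fix n
    have "c * exp (- real (Suc (Suc n))) \<le> c * exp (- real (Suc n))"
         "c * exp (real (Suc n)) \<le> c * exp (real (Suc (Suc n)))"
      using c by auto
    then show "{c * exp (- real (Suc n))..c * exp (real (Suc n))}
        \<subseteq> {c * exp (- real (Suc (Suc n)))..c * exp (real (Suc (Suc n)))}"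
      by (simp only: atLeastatMost_subset_iff) auto
  qed
  have un1: "(\<Union>n. {- real (Suc n)..real (Suc n)}) = UNIV"
  proof -
    have "\<exists>n. x \<in> {- real (Suc n)..real (Suc n)}" for x :: real
    proof -
      obtain n where "\<bar>x\<bar> \<le> real n" using real_arch_simple by blast
      then have "x \<in> {- real (Suc n)..real (Suc n)}" by auto
      then show ?thesis ..
    qed
    then show ?thesis by blast
  qed
  have un2: "(\<Union>n. {c * exp (- real (Suc n))..c * exp (real (Suc n))}) = {0<..}"
  proof (intro set_eqI iffI)
    fix z :: real assume "z \<in> {0<..}"
    then have z: "z = c * exp (ln (z / c))" using c by simp
    obtain n where "ln (z / c) \<in> {- real (Suc n)..real (Suc n)}" using un1 by blast
    then have "z \<in> {c * exp (- real (Suc n))..c * exp (real (Suc n))}"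
      using c by (subst (1) z) (simp del: exp_ln)
    then show "z \<in> (\<Union>n. {c * exp (- real (Suc n))..c * exp (real (Suc n))})" by blast
  next
    fix z :: real assume "z \<in> (\<Union>n. {c * exp (- real (Suc n))..c * exp (real (Suc n))})"
    then obtain n where "c * exp (- real (Suc n)) \<le> z" by auto
    moreover have "0 < c * exp (- real (Suc n))" using c by simp
    ultimately show "z \<in> {0<..}" by (metis greaterThan_iff less_le_trans)
  qed
  \<comment> \<open>Monotone convergence over growing domains, read off from continuity from below
    of the measure with density \<open>h\<close>.\<close>
  have SUP_ind: "(\<integral>\<^sup>+x. h x * indicator (\<Union>n. S n) x \<partial>lborel)
      = (SUP n. \<integral>\<^sup>+x. h x * indicator (S n) x \<partial>lborel)"
    if [measurable]: "h \<in> borel_measurable borel" and "\<And>n. S n \<in> sets borel" "incseq S"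
    for h :: "real \<Rightarrow> ennreal" and S
    using SUP_emeasure_incseq[of S "density lborel h"] that
    by (auto simp: emeasure_density image_subset_iff)
  have "(\<integral>\<^sup>+x. f (c * exp x) \<partial>lborel)
      = (\<integral>\<^sup>+x. f (c * exp x) * indicator (\<Union>n. {- real (Suc n)..real (Suc n)}) x \<partial>lborel)"
    unfolding un1 by simp
  also have "\<dots> = (SUP n. \<integral>\<^sup>+x. f (c * exp x) * indicator {- real (Suc n)..real (Suc n)} x \<partial>lborel)"
    by (rule SUP_ind[OF _ _ inc1]) auto
  also have "\<dots> = (SUP n. \<integral>\<^sup>+z. ?g z * indicator {c * exp (- real (Suc n))..c * exp (real (Suc n))} z \<partial>lborel)"
    unfolding sub ..
  also have "\<dots> = (\<integral>\<^sup>+z. ?g z * indicator (\<Union>n. {c * exp (- real (Suc n))..c * exp (real (Suc n))}) z \<partial>lborel)"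
    by (rule SUP_ind[OF _ _ inc2, symmetric]) auto
  finally show ?thesis unfolding un2 .
qed

lemma borel_measurable_cosh [measurable]: "(cosh :: real \<Rightarrow> real) \<in> borel_measurable borel"
proof -
  have "(\<lambda>x::real. (exp x + exp (- x)) / 2) \<in> borel_measurable borel" by measurable
  then show ?thesis by (simp add: cosh_field_def[abs_def])
qed

text \<open>This algebra is the source of the symmetry: z' is the ratio that follows z when the walk
  moves from x to x', and on the right x' occurs outside z' only through the even function cosh. In
  a = exp x and b = exp x' both sides are rational.\<close>

lemma cosh_exponent_eq:
  fixes x x' z h :: real
  assumes "z > 0" "h > 0"
  defines "z' \<equiv> (z * exp (- x') + h) * exp x"
  shows "cosh x / z + cosh (x' - x) / h
       = (z'\<^sup>2 + z\<^sup>2 + h\<^sup>2) / (2 * z * h * z') + cosh x' / z'"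
proof -
  define a b where "a = exp x" and "b = exp x'"
  have pos: "a > 0" "b > 0" by (simp_all add: a_def b_def)
  have pos': "z + h * b > 0" using assms(1,2) pos by (simp add: add_pos_pos)
  have z': "z' = (z + h * b) * a / b"
    using pos by (simp add: z'_def a_def[symmetric] b_def[symmetric] exp_minus field_simps)
  have c: "cosh x = (a + 1 / a) / 2" "cosh x' = (b + 1 / b) / 2"
          "cosh (x' - x) = (b / a + a / b) / 2"
    using pos by (simp_all add: cosh_def a_def b_def exp_minus exp_diff field_simps)
  have 1: "(z + h * b) * a / b / (2 * z * h) = (a / (2 * z)) + (a / b) / (2 * h)"
    using assms(1,2) pos by (simp add: field_simps)
  have 2: "((z\<^sup>2 + h\<^sup>2) / (z * h) + (b + 1 / b)) / (2 * ((z + h * b) * a / b))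
       = 1 / (2 * a * z) + b / (2 * a * h)"
  proof -
    \<comment> \<open>The factor z + h * b of the numerator is also a factor of z', so it
      cancels.\<close>
    have eq: "((z\<^sup>2 + h\<^sup>2) / (z * h) + (b + 1 / b)) = (z + h * b) * (h + z * b) / (z * h * b)"
      using assms(1,2) pos by (simp add: field_simps power2_eq_square)
    have "s * k / (z * h * b) / (2 * (s * a / b)) = k / (2 * a * z * h)" if "s > 0" for s k :: real
      using assms(1,2) pos that by (simp add: field_simps)
    from this[OF pos', of "h + z * b"] have "((z\<^sup>2 + h\<^sup>2) / (z * h) + (b + 1 / b)) / (2 * ((z + h * b) * a / b))
        = (h + z * b) / (2 * a * z * h)"
      by (simp only: eq)
    also have "\<dots> = 1 / (2 * a * z) + b / (2 * a * h)"
      using assms(1,2) pos by (simp add: field_simps)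
    finally show ?thesis .
  qed
  have "(z'\<^sup>2 + z\<^sup>2 + h\<^sup>2) / (2 * z * h * z') + cosh x' / z'
      = z' / (2 * z * h) + ((z\<^sup>2 + h\<^sup>2) / (z * h) + (b + 1 / b)) / (2 * z')"
  proof -
    have "z' \<noteq> 0" using z' pos pos' by simp
    then show ?thesis using assms(1,2) pos
      by (simp add: c add_divide_distrib power2_eq_square)
  qed
  also have "\<dots> = cosh x / z + cosh (x' - x) / h"
    unfolding z' 1 2 c by (simp add: add_divide_distrib)
  finally show ?thesis ..
qed

text \<open>One step of the intertwining: if the position \<open>x\<close> has the symmetric weight
  \<open>exp (- cosh x / z)\<close> before a step, it has the weight \<open>exp (- cosh x' / z')\<close> after the step,
  jointly with the new value \<open>z'\<close>.\<close>

lemma nn_integral_cosh_step: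
  fixes G :: "real \<times> real \<Rightarrow> ennreal"
  assumes [measurable]: "G \<in> borel_measurable (borel \<Otimes>\<^sub>M borel)" and z: "z > 0" and h: "h > 0"
  shows "(\<integral>\<^sup>+x. (\<integral>\<^sup>+d. G (z * exp (- d) + h * exp x, x + d) * ennreal (exp (- cosh d / h)) \<partial>lborel)
            * ennreal (exp (- cosh x / z)) \<partial>lborel)
       = (\<integral>\<^sup>+z'. (\<integral>\<^sup>+x'. G (z', x') * ennreal (exp (- cosh x' / z')) \<partial>lborel)
            * (ennreal (exp (- ((z'\<^sup>2 + z\<^sup>2 + h\<^sup>2) / (2 * z * h * z')))) * ennreal (1 / z')
                * indicator {0<..} z') \<partial>lborel)"
proof -
  define f where "f x' z' = G (z', x') * ennreal (exp (- cosh x' / z')) *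
    ennreal (exp (- ((z'\<^sup>2 + z\<^sup>2 + h\<^sup>2) / (2 * z * h * z'))))" for x' z'
  \<comment> \<open>For a fixed end point x' the new ratio is \<open>c x' * exp x\<close>, so the
    starting point x can be traded for z' with dx = dz' / z'. This is why x' becomes the outer
    variable before the substitution.\<close>
  define c where "c x' = z * exp (- x') + h" for x'
  have c: "c x' > 0" for x' using z h by (simp add: c_def add_pos_pos)
  have [measurable]: "case_prod f \<in> borel_measurable (borel \<Otimes>\<^sub>M borel)"
    unfolding f_def by measurable
  have [measurable]: "(\<lambda>x. f a x) \<in> borel_measurable borel" for a
    unfolding f_def by measurable
  have [measurable]: "c \<in> borel_measurable borel" unfolding c_def by measurable
  have inner: "(\<integral>\<^sup>+d. G (z * exp (- d) + h * exp x, x + d) * ennreal (exp (- cosh d / h)) \<partial>lborel)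
      * ennreal (exp (- cosh x / z)) = (\<integral>\<^sup>+x'. f x' (c x' * exp x) \<partial>lborel)" for x
  proof -
    have shift: "(\<integral>\<^sup>+d. G (z * exp (- d) + h * exp x, x + d) * ennreal (exp (- cosh d / h)) \<partial>lborel)
       = (\<integral>\<^sup>+x'. G (z * exp (- (x' - x)) + h * exp x, x') * ennreal (exp (- cosh (x' - x) / h)) \<partial>lborel)"
      by (subst nn_integral_real_affine[where t = "- x" and c = 1]) auto
    have "(\<integral>\<^sup>+x'. G (z * exp (- (x' - x)) + h * exp x, x') * ennreal (exp (- cosh (x' - x) / h)) \<partial>lborel)
        * ennreal (exp (- cosh x / z)) = (\<integral>\<^sup>+x'. G (z * exp (- (x' - x)) + h * exp x, x')
        * ennreal (exp (- cosh (x' - x) / h)) * ennreal (exp (- cosh x / z)) \<partial>lborel)"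
      by (rule nn_integral_multc[symmetric]) measurable
    also have "\<dots> = (\<integral>\<^sup>+x'. f x' (c x' * exp x) \<partial>lborel)"
    proof (rule nn_integral_cong)
      fix x'
      have 1: "z * exp (- (x' - x)) + h * exp x = c x' * exp x"
      proof -
        have "exp (- (x' - x)) = exp (- x') * exp x" by (simp add: exp_add[symmetric])
        then show ?thesis unfolding c_def by (simp only: distrib_right mult.assoc)
      qed
      have mult_exp: "ennreal (exp (- u)) * ennreal (exp (- v)) = ennreal (exp (- (v + u)))" for u v
        by (simp only: ennreal_mult[OF exp_ge_zero exp_ge_zero, symmetric] exp_add[symmetric] minus_add)
      have 2: "ennreal (exp (- cosh (x' - x) / h)) * ennreal (exp (- cosh x / z))
        = ennreal (exp (- cosh x' / (c x' * exp x))) *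
         ennreal (exp (- (((c x' * exp x)\<^sup>2 + z\<^sup>2 + h\<^sup>2) / (2 * z * h * (c x' * exp x)))))"
        unfolding minus_divide_left[symmetric] mult_exp c_def cosh_exponent_eq[OF z h, of x x'] ..
      show "G (z * exp (- (x' - x)) + h * exp x, x') * ennreal (exp (- cosh (x' - x) / h))
          * ennreal (exp (- cosh x / z)) = f x' (c x' * exp x)"
        unfolding f_def 1 by (simp only: mult.assoc 2)
    qed
    finally show ?thesis unfolding shift .
  qed
  have "(\<integral>\<^sup>+x. (\<integral>\<^sup>+d. G (z * exp (- d) + h * exp x, x + d) * ennreal (exp (- cosh d / h)) \<partial>lborel)
            * ennreal (exp (- cosh x / z)) \<partial>lborel)
      = (\<integral>\<^sup>+x'. \<integral>\<^sup>+x. f x' (c x' * exp x) \<partial>lborel \<partial>lborel)"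
    unfolding inner by (rule lborel_pair.Fubini') measurable
  also have "\<dots> = (\<integral>\<^sup>+x'. \<integral>\<^sup>+z'. f x' z' * ennreal (1 / z') * indicator {0<..} z' \<partial>lborel \<partial>lborel)"
    by (intro nn_integral_cong nn_integral_exp_substitution c) measurable
  also have "\<dots> = (\<integral>\<^sup>+z'. \<integral>\<^sup>+x'. f x' z' * ennreal (1 / z') * indicator {0<..} z' \<partial>lborel \<partial>lborel)"
    by (rule lborel_pair.Fubini') measurable
  also have "\<dots> = (\<integral>\<^sup>+z'. (\<integral>\<^sup>+x'. G (z', x') * ennreal (exp (- cosh x' / z')) \<partial>lborel)
            * (ennreal (exp (- ((z'\<^sup>2 + z\<^sup>2 + h\<^sup>2) / (2 * z * h * z')))) * ennreal (1 / z')
                * indicator {0<..} z') \<partial>lborel)"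
    unfolding f_def
    by (subst nn_integral_multc[symmetric]) (auto simp: mult.assoc intro!: nn_integral_cong)
  finally show ?thesis .
qed

subsection \<open>Symmetry of a walk with steps of density proportional to exp (- cosh x / h)\<close>

definition walk :: "(nat \<Rightarrow> real) \<Rightarrow> nat \<Rightarrow> real" where
  "walk \<delta> k = (\<Sum>i<k. \<delta> i)"

text \<open>A Riemann sum for the integral of exp (2 X) in which each cell takes the geometric mean
  of its two end values. With this choice both the recursion of the ratio and the telescoping of 1 /
  A are exact, not only asymptotic.\<close>

definition expsum :: "real \<Rightarrow> (nat \<Rightarrow> real) \<Rightarrow> nat \<Rightarrow> real" where
  "expsum h \<delta> k = h * (\<Sum>j<k. exp (walk \<delta> j + walk \<delta> (Suc j)))"

definition ratio :: "real \<Rightarrow> (nat \<Rightarrow> real) \<Rightarrow> nat \<Rightarrow> real" where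
  "ratio h \<delta> k = expsum h \<delta> k * exp (- walk \<delta> k)"

text \<open>Padding by 0 puts the paths of all lengths into one measurable space, and a further step
  becomes a function update.\<close>

definition history :: "real \<Rightarrow> nat \<Rightarrow> (nat \<Rightarrow> real) \<Rightarrow> nat \<Rightarrow> real" where
  "history h n \<delta> = (\<lambda>k. if 1 \<le> k \<and> k \<le> n then ratio h \<delta> k else 0)"

text \<open>Up to a constant factor, the density of a cosh step with respect to the centred Gaussian
  of variance h. The subtracted terms are the Taylor polynomial of cosh, which makes the weight at
  most 1 and close to 1 near 0.\<close>

definition cosh_weight :: "real \<Rightarrow> real \<Rightarrow> real" where
  "cosh_weight h x = exp (- (cosh x - 1 - x\<^sup>2 / 2) / h)"

abbreviation normal_measure :: "real \<Rightarrow> real measure" where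
  "normal_measure h \<equiv> density lborel (\<lambda>x. ennreal (normal_density 0 (sqrt h) x))"

lemma walk_Suc [simp]: "walk \<delta> (Suc k) = walk \<delta> k + \<delta> k"
  by (simp add: walk_def)

lemma walk_0 [simp]: "walk \<delta> 0 = 0"
  by (simp add: walk_def)

lemma walk_cong: "(\<And>i. i < k \<Longrightarrow> \<delta> i = \<delta>' i) \<Longrightarrow> walk \<delta> k = walk \<delta>' k"
  by (simp add: walk_def)

lemma expsum_cong:
  assumes "\<And>i. i < k \<Longrightarrow> \<delta> i = \<delta>' i"
  shows "expsum h \<delta> k = expsum h \<delta>' k"
proof -
  have "walk \<delta> j = walk \<delta>' j" if "j \<le> k" for j
    using that assms by (intro walk_cong) auto
  then show ?thesis unfolding expsum_def by (simp del: walk_Suc)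
qed

text \<open>The new cell contributes h * exp (X_k + X_{k+1}) * exp (- X_{k+1}), from which the new
  position cancels.\<close>

lemma ratio_Suc: "ratio h \<delta> (Suc k) = ratio h \<delta> k * exp (- \<delta> k) + h * exp (walk \<delta> k)"
proof -
  have "exp (walk \<delta> k + (walk \<delta> k + \<delta> k)) * exp (- (walk \<delta> k + \<delta> k)) = exp (walk \<delta> k)"
    by (simp add: exp_add[symmetric])
  moreover have "exp (- (walk \<delta> k + \<delta> k)) = exp (- walk \<delta> k) * exp (- \<delta> k)"
    by (simp add: exp_add[symmetric])
  moreover have "h * (S + e) * x = h * S * u * v + h * r" if "e * x = r" "x = u * v" for S e x u v r :: real
    using that by (simp add: distrib_left distrib_right mult.assoc)
  ultimately show ?thesis
    unfolding ratio_def expsum_def walk_Suc sum.lessThan_Suc by blast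
qed

lemma expsum_pos: "h > 0 \<Longrightarrow> k > 0 \<Longrightarrow> expsum h \<delta> k > 0"
  unfolding expsum_def by (intro mult_pos_pos sum_pos) auto

lemma ratio_pos: "h > 0 \<Longrightarrow> k > 0 \<Longrightarrow> ratio h \<delta> k > 0"
  by (simp add: ratio_def expsum_pos)

lemma measurable_walk [measurable (raw)]:
  "(\<And>i. i < k \<Longrightarrow> (\<lambda>\<omega>. \<delta> \<omega> i) \<in> borel_measurable M) \<Longrightarrow> (\<lambda>\<omega>. walk (\<delta> \<omega>) k) \<in> borel_measurable M"
  unfolding walk_def by (intro borel_measurable_sum) auto

lemma measurable_ratio:
  assumes "\<And>i. i < k \<Longrightarrow> (\<lambda>\<omega>. \<delta> \<omega> i) \<in> borel_measurable M"
  shows "(\<lambda>\<omega>. ratio h (\<delta> \<omega>) k) \<in> borel_measurable M"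
proof -
  have "(\<lambda>\<omega>. walk (\<delta> \<omega>) j) \<in> borel_measurable M" if "j \<le> k" for j
    using that assms by (intro measurable_walk) auto
  then show ?thesis unfolding ratio_def expsum_def
    by (intro borel_measurable_times borel_measurable_sum measurable_compose[OF _ borel_measurable_exp]
        borel_measurable_add borel_measurable_const borel_measurable_uminus)
      (auto simp del: walk_Suc)
qed

lemma measurable_history:
  assumes "\<And>i. i < n \<Longrightarrow> (\<lambda>\<omega>. \<delta> \<omega> i) \<in> borel_measurable M"
  shows "(\<lambda>\<omega>. history h n (\<delta> \<omega>)) \<in> measurable M (Pi\<^sub>M UNIV (\<lambda>_. borel))"
proof (rule measurable_PiM_single')
  fix k :: nat
  show "(\<lambda>\<omega>. history h n (\<delta> \<omega>) k) \<in> borel_measurable M"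
    using assms by (cases "1 \<le> k \<and> k \<le> n") (auto simp: history_def intro!: measurable_ratio)
qed auto

lemma history_fun_upd:
  "history h (Suc n) (\<delta>(n := y)) =
     (history h n \<delta>)(Suc n := ratio h \<delta> n * exp (- y) + h * exp (walk \<delta> n))"
proof
  fix k
  have [simp]: "walk (\<delta>(n := y)) j = walk \<delta> j" if "j \<le> n" for j
    using that by (intro walk_cong) auto
  have [simp]: "ratio h (\<delta>(n := y)) j = ratio h \<delta> j" if "j \<le> n" for j
    using that by (auto simp: ratio_def intro: expsum_cong)
  show "history h (Suc n) (\<delta>(n := y)) k =
     ((history h n \<delta>)(Suc n := ratio h \<delta> n * exp (- y) + h * exp (walk \<delta> n))) k"
    by (cases "k = Suc n") (auto simp: history_def ratio_Suc)
qed

lemma cosh_weight_normal_density: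
  assumes "h > 0"
  shows "normal_density 0 (sqrt h) x * cosh_weight h x
       = exp (1 / h) / sqrt (2 * pi * h) * exp (- cosh x / h)"
proof -
  have "- (x\<^sup>2 / (2 * h)) + - (cosh x - 1 - x\<^sup>2 / 2) / h = 1 / h + - cosh x / h"
    by (simp add: diff_divide_distrib)
  then have "exp (- (x\<^sup>2 / (2 * h))) * exp (- (cosh x - 1 - x\<^sup>2 / 2) / h) = exp (1 / h) * exp (- cosh x / h)"
    by (simp only: exp_add[symmetric])
  then show ?thesis using assms
    by (simp add: normal_density_def cosh_weight_def del: minus_diff_eq minus_divide_left)
qed

lemma cosh_weight_nonneg [simp]: "0 \<le> cosh_weight h x"
  by (simp add: cosh_weight_def)

lemma borel_measurable_cosh_weight [measurable]: "cosh_weight h \<in> borel_measurable borel"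
  unfolding cosh_weight_def[abs_def] by measurable

lemma nn_integral_cosh_weight:
  fixes f :: "real \<Rightarrow> ennreal"
  assumes h: "h > 0" and [measurable]: "f \<in> borel_measurable borel"
  shows "(\<integral>\<^sup>+y. ennreal (cosh_weight h y) * f y \<partial>normal_measure h)
    = ennreal (exp (1 / h) / sqrt (2 * pi * h)) * (\<integral>\<^sup>+y. f y * ennreal (exp (- cosh y / h)) \<partial>lborel)"
proof -
  have "(\<integral>\<^sup>+y. ennreal (cosh_weight h y) * f y \<partial>normal_measure h)
      = (\<integral>\<^sup>+y. ennreal (normal_density 0 (sqrt h) y) * (ennreal (cosh_weight h y) * f y) \<partial>lborel)"
    by (rule nn_integral_density) measurable
  also have "\<dots> = (\<integral>\<^sup>+y. ennreal (exp (1 / h) / sqrt (2 * pi * h)) * (f y * ennreal (exp (- cosh y / h))) \<partial>lborel)"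
  proof (rule nn_integral_cong)
    fix y
    have "ennreal (normal_density 0 (sqrt h) y) * ennreal (cosh_weight h y)
        = ennreal (exp (1 / h) / sqrt (2 * pi * h)) * ennreal (exp (- cosh y / h))"
      using cosh_weight_normal_density[OF h, of y] h
      by (simp add: ennreal_mult[symmetric])
    then show "ennreal (normal_density 0 (sqrt h) y) * (ennreal (cosh_weight h y) * f y) =
        ennreal (exp (1 / h) / sqrt (2 * pi * h)) * (f y * ennreal (exp (- cosh y / h)))"
      by (metis mult.assoc mult.commute)
  qed
  also have "\<dots> = ennreal (exp (1 / h) / sqrt (2 * pi * h)) * (\<integral>\<^sup>+y. f y * ennreal (exp (- cosh y / h)) \<partial>lborel)"
    by (rule nn_integral_cmult) measurable
  finally show ?thesis .
qed

lemma measurable_fun_upd_UNIV [measurable (raw)]: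
  fixes f :: "'a \<Rightarrow> 'i \<Rightarrow> real"
  assumes [measurable]: "f \<in> measurable M (Pi\<^sub>M UNIV (\<lambda>_. borel))" "g \<in> borel_measurable M"
  shows "(\<lambda>\<omega>. (f \<omega>)(k := g \<omega>)) \<in> measurable M (Pi\<^sub>M UNIV (\<lambda>_. borel))"
proof (rule measurable_PiM_single')
  fix i :: 'i
  have "(\<lambda>\<omega>. f \<omega> i) \<in> borel_measurable M"
    by (rule measurable_compose[OF assms(1) measurable_component_singleton]) simp
  then show "(\<lambda>\<omega>. ((f \<omega>)(k := g \<omega>)) i) \<in> borel_measurable M"
    by (cases "i = k") auto
qed auto

lemma measurable_fun_upd_section:
  fixes H :: "(nat \<Rightarrow> real) \<times> real \<Rightarrow> ennreal"
  assumes [measurable]: "H \<in> borel_measurable (Pi\<^sub>M UNIV (\<lambda>_. borel) \<Otimes>\<^sub>M borel)"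
  shows "(\<lambda>(z, x). H (\<zeta>(k := z), x)) \<in> borel_measurable (borel \<Otimes>\<^sub>M borel)"
proof -
  have "(\<lambda>p. H (\<zeta>(k := fst p), snd p)) \<in> borel_measurable (borel \<Otimes>\<^sub>M borel)"
    by (rule measurable_compose[OF measurable_Pair assms]) (auto simp: space_PiM)
  then show ?thesis by (simp add: case_prod_beta')
qed

text \<open>Given the path of \<open>ratio\<close>, the end point of the walk has a density proportional to
  \<open>exp (- cosh x / z)\<close>, where \<open>z\<close> is the last ratio. An unspecified functional \<open>I\<close> stands for
  integration over the path, so that no law of the path has to be constructed.\<close>

lemma cosh_walk_disintegration:
  assumes h: "h > 0"
  shows "\<exists>I :: ((nat \<Rightarrow> real) \<Rightarrow> ennreal) \<Rightarrow> ennreal.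
    \<forall>H \<in> borel_measurable (Pi\<^sub>M UNIV (\<lambda>_. borel) \<Otimes>\<^sub>M borel).
      (\<integral>\<^sup>+\<delta>. (\<Prod>i<Suc n. ennreal (cosh_weight h (\<delta> i))) * H (history h (Suc n) \<delta>, walk \<delta> (Suc n))
          \<partial>Pi\<^sub>M {..<Suc n} (\<lambda>_. normal_measure h))
      = I (\<lambda>\<zeta>. \<integral>\<^sup>+x. H (\<zeta>, x) * ennreal (exp (- cosh x / \<zeta> (Suc n))) \<partial>lborel)"
proof -
  define C where "C = ennreal (exp (1 / h) / sqrt (2 * pi * h))"
  interpret N: prob_space "normal_measure h"
    using h by (intro prob_space_normal_density) simp
  interpret P: product_prob_space "\<lambda>_::nat. normal_measure h" UNIV
    by unfold_locales
  have sets_P: "sets (Pi\<^sub>M J (\<lambda>_. normal_measure h)) = sets (Pi\<^sub>M J (\<lambda>_. borel))" for J :: "nat set"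
    by (intro sets_PiM_cong) auto
  \<comment> \<open>The last of the m + 1 steps is integrated out. Its Gaussian density and its
    weight combine to \<open>C\<close> times exp (- cosh y / h), the form needed for
    \<open>nn_integral_cosh_step\<close>.\<close>
  have split: "(\<integral>\<^sup>+\<delta>. (\<Prod>i<Suc m. ennreal (cosh_weight h (\<delta> i))) * H (history h (Suc m) \<delta>, walk \<delta> (Suc m))
          \<partial>Pi\<^sub>M {..<Suc m} (\<lambda>_. normal_measure h))
     = (\<integral>\<^sup>+\<delta>. (\<Prod>i<m. ennreal (cosh_weight h (\<delta> i))) *
          (C * (\<integral>\<^sup>+y. H ((history h m \<delta>)(Suc m := ratio h \<delta> m * exp (- y) + h * exp (walk \<delta> m)), walk \<delta> m + y)
              * ennreal (exp (- cosh y / h)) \<partial>lborel))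
          \<partial>Pi\<^sub>M {..<m} (\<lambda>_. normal_measure h))" (is "?L = ?R")
    if H [measurable]: "H \<in> borel_measurable (Pi\<^sub>M UNIV (\<lambda>_. borel) \<Otimes>\<^sub>M borel)" for m H
  proof -
    have [measurable]: "(\<lambda>\<delta>. \<delta> i) \<in> borel_measurable (Pi\<^sub>M {..<k} (\<lambda>_. normal_measure h))" if "i < k" for i k
    proof -
      have "(\<lambda>\<delta>. \<delta> i) \<in> measurable (Pi\<^sub>M {..<k} (\<lambda>_. normal_measure h)) (normal_measure h)"
        using that by (intro measurable_component_singleton) auto
      then show ?thesis by simp
    qed
    have [measurable]: "(\<lambda>\<delta>. walk \<delta> k) \<in> borel_measurable (Pi\<^sub>M {..<k} (\<lambda>_. normal_measure h))" for k
      by (intro measurable_walk) measurable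
    have [measurable]: "history h k \<in> measurable (Pi\<^sub>M {..<k} (\<lambda>_. normal_measure h)) (Pi\<^sub>M UNIV (\<lambda>_. borel))" for k
      by (intro measurable_history) measurable
    have [measurable]: "(\<lambda>\<delta>. \<Prod>i<k. ennreal (cosh_weight h (\<delta> i))) \<in> borel_measurable (Pi\<^sub>M {..<k} (\<lambda>_. normal_measure h))" for k
    proof (intro borel_measurable_prod_ennreal measurable_compose[OF _ measurable_ennreal] measurable_compose[OF _ borel_measurable_cosh_weight])
    qed auto
    have upd [measurable]: "(\<lambda>y. H ((history h m \<delta>)(Suc m := ratio h \<delta> m * exp (- y)
          + h * exp (walk \<delta> m)), walk \<delta> m + y)) \<in> borel_measurable borel" for \<delta>
      using measurable_compose[OF _ measurable_fun_upd_section[OF H, of "history h m \<delta>" "Suc m"],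
            of "\<lambda>y. (ratio h \<delta> m * exp (- y) + h * exp (walk \<delta> m), walk \<delta> m + y)" borel]
      by simp
    have "?L = (\<integral>\<^sup>+\<delta>. (\<integral>\<^sup>+y. (\<Prod>i<Suc m. ennreal (cosh_weight h ((\<delta>(m := y)) i)))
          * H (history h (Suc m) (\<delta>(m := y)), walk (\<delta>(m := y)) (Suc m)) \<partial>normal_measure h)
          \<partial>Pi\<^sub>M {..<m} (\<lambda>_. normal_measure h))"
      unfolding lessThan_Suc
      by (intro P.product_nn_integral_insert) (auto simp: lessThan_Suc[symmetric] simp del: walk_Suc)
    also have "\<dots> = (\<integral>\<^sup>+\<delta>. (\<Prod>i<m. ennreal (cosh_weight h (\<delta> i))) *
        (\<integral>\<^sup>+y. ennreal (cosh_weight h y) * H ((history h m \<delta>)(Suc m := ratio h \<delta> m * exp (- y) + h * exp (walk \<delta> m)), walk \<delta> m + y)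
          \<partial>normal_measure h) \<partial>Pi\<^sub>M {..<m} (\<lambda>_. normal_measure h))"
    proof (intro nn_integral_cong)
      fix \<delta> :: "nat \<Rightarrow> real"
      have w: "walk (\<delta>(m := y)) (Suc m) = walk \<delta> m + y" for y
        using walk_cong[of m "\<delta>(m := y)" \<delta>] by simp
      have "(\<Prod>i<Suc m. ennreal (cosh_weight h ((\<delta>(m := y)) i)))
          = (\<Prod>i<m. ennreal (cosh_weight h (\<delta> i))) * ennreal (cosh_weight h y)" for y
        by simp
      then show "(\<integral>\<^sup>+y. (\<Prod>i<Suc m. ennreal (cosh_weight h ((\<delta>(m := y)) i)))
          * H (history h (Suc m) (\<delta>(m := y)), walk (\<delta>(m := y)) (Suc m)) \<partial>normal_measure h)
        = (\<Prod>i<m. ennreal (cosh_weight h (\<delta> i))) *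
        (\<integral>\<^sup>+y. ennreal (cosh_weight h y) * H ((history h m \<delta>)(Suc m := ratio h \<delta> m * exp (- y) + h * exp (walk \<delta> m)), walk \<delta> m + y)
          \<partial>normal_measure h)"
        unfolding w history_fun_upd by (subst nn_integral_cmult[symmetric]) (auto simp: mult.assoc)
    qed
    also have "\<dots> = ?R"
      unfolding C_def by (intro nn_integral_cong arg_cong2[where f = "(*)"] refl nn_integral_cosh_weight h upd)
    finally show ?thesis .
  qed
  show ?thesis
  proof (induction n)
    case 0
    show ?case
    \<comment> \<open>After one step the ratio equals h whatever the step was, so the path is
      constant and only the end point remains to be integrated.\<close>
    proof (intro exI[of _ "\<lambda>g. C * g (\<lambda>k. if k = 1 then h else 0)"] ballI)
      fix H :: "(nat \<Rightarrow> real) \<times> real \<Rightarrow> ennreal"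
      assume H: "H \<in> borel_measurable (Pi\<^sub>M UNIV (\<lambda>_. borel) \<Otimes>\<^sub>M borel)"
      have [simp]: "(history h 0 \<delta>)(Suc 0 := ratio h \<delta> 0 * exp (- y) + h) = (\<lambda>k. if k = 1 then h else 0)" for \<delta> y
        by (auto simp: history_def ratio_def expsum_def)
      show "(\<integral>\<^sup>+\<delta>. (\<Prod>i<Suc 0. ennreal (cosh_weight h (\<delta> i))) * H (history h (Suc 0) \<delta>, walk \<delta> (Suc 0))
          \<partial>Pi\<^sub>M {..<Suc 0} (\<lambda>_. normal_measure h))
       = C * (\<integral>\<^sup>+x. H (\<lambda>k. if k = 1 then h else 0, x) * ennreal (exp (- cosh x / (if Suc 0 = 1 then h else 0))) \<partial>lborel)"
        unfolding split[OF H] by (simp add: PiM_empty)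
    qed
  next
    case (Suc n)
    then obtain I :: "((nat \<Rightarrow> real) \<Rightarrow> ennreal) \<Rightarrow> ennreal" where
      I: "\<And>H. H \<in> borel_measurable (Pi\<^sub>M UNIV (\<lambda>_. borel) \<Otimes>\<^sub>M borel) \<Longrightarrow>
      (\<integral>\<^sup>+\<delta>. (\<Prod>i<Suc n. ennreal (cosh_weight h (\<delta> i))) * H (history h (Suc n) \<delta>, walk \<delta> (Suc n))
          \<partial>Pi\<^sub>M {..<Suc n} (\<lambda>_. normal_measure h))
      = I (\<lambda>\<zeta>. \<integral>\<^sup>+x. H (\<zeta>, x) * ennreal (exp (- cosh x / \<zeta> (Suc n))) \<partial>lborel)"
      by blast
    define \<kappa> where "\<kappa> z z' = ennreal (exp (- ((z'\<^sup>2 + z\<^sup>2 + h\<^sup>2) / (2 * z * h * z')))) * ennreal (1 / z')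
                * indicator {0<..} z'" for z z' :: real
    show ?case
    proof (intro exI[of _ "\<lambda>g. I (\<lambda>\<zeta>. C * indicator {0<..} (\<zeta> (Suc n)) *
        (\<integral>\<^sup>+z'. g (\<zeta>(Suc (Suc n) := z')) * \<kappa> (\<zeta> (Suc n)) z' \<partial>lborel))"] ballI)
      fix H :: "(nat \<Rightarrow> real) \<times> real \<Rightarrow> ennreal"
      assume H [measurable]: "H \<in> borel_measurable (Pi\<^sub>M UNIV (\<lambda>_. borel) \<Otimes>\<^sub>M borel)"
      define H' where "H' = (\<lambda>(\<zeta>, x). C * indicator {0<..} (\<zeta> (Suc n)) *
         (\<integral>\<^sup>+y. H (\<zeta>(Suc (Suc n) := \<zeta> (Suc n) * exp (- y) + h * exp x), x + y)
              * ennreal (exp (- cosh y / h)) \<partial>lborel))"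
      have H'_meas: "H' \<in> borel_measurable (Pi\<^sub>M UNIV (\<lambda>_. borel) \<Otimes>\<^sub>M borel)"
      proof -
        let ?B = "Pi\<^sub>M UNIV (\<lambda>_. borel) :: (nat \<Rightarrow> real) measure"
        have comp: "(\<lambda>\<zeta>. \<zeta> (Suc n)) \<in> borel_measurable ?B"
          by (rule measurable_component_singleton) simp
        have [measurable]: "(\<lambda>p. fst p (Suc n)) \<in> borel_measurable (?B \<Otimes>\<^sub>M borel)"
          "(\<lambda>q. fst (fst q) (Suc n)) \<in> borel_measurable ((?B \<Otimes>\<^sub>M borel) \<Otimes>\<^sub>M lborel)"
          by (rule measurable_compose[OF _ comp]; measurable)+
        have "(\<lambda>q. (fst (fst q))(Suc (Suc n) := fst (fst q) (Suc n) * exp (- snd q) + h * exp (snd (fst q))))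
            \<in> measurable ((?B \<Otimes>\<^sub>M borel) \<Otimes>\<^sub>M lborel) ?B"
          by (rule measurable_fun_upd_UNIV) measurable
        moreover have "(\<lambda>q. snd (fst q) + snd q) \<in> borel_measurable ((?B \<Otimes>\<^sub>M borel) \<Otimes>\<^sub>M lborel)"
          by (rule borel_measurable_add) measurable
        ultimately have [measurable]: "(\<lambda>q. H ((fst (fst q))(Suc (Suc n) := fst (fst q) (Suc n) * exp (- snd q) + h * exp (snd (fst q))),
            snd (fst q) + snd q)) \<in> borel_measurable ((?B \<Otimes>\<^sub>M borel) \<Otimes>\<^sub>M lborel)"
          by (rule measurable_compose[OF measurable_Pair H])
        show ?thesis unfolding H'_def case_prod_beta' by measurable
      qed
      have "(\<integral>\<^sup>+\<delta>. (\<Prod>i<Suc (Suc n). ennreal (cosh_weight h (\<delta> i))) * H (history h (Suc (Suc n)) \<delta>, walk \<delta> (Suc (Suc n)))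
          \<partial>Pi\<^sub>M {..<Suc (Suc n)} (\<lambda>_. normal_measure h))
        = (\<integral>\<^sup>+\<delta>. (\<Prod>i<Suc n. ennreal (cosh_weight h (\<delta> i))) * H' (history h (Suc n) \<delta>, walk \<delta> (Suc n))
          \<partial>Pi\<^sub>M {..<Suc n} (\<lambda>_. normal_measure h))"
        unfolding split[OF H] H'_def using ratio_pos[OF h]
        by (simp add: history_def del: walk_Suc prod.lessThan_Suc)
      also have "\<dots> = I (\<lambda>\<zeta>. \<integral>\<^sup>+x. H' (\<zeta>, x) * ennreal (exp (- cosh x / \<zeta> (Suc n))) \<partial>lborel)"
        by (rule I[OF H'_meas])
      also have "(\<lambda>\<zeta>. \<integral>\<^sup>+x. H' (\<zeta>, x) * ennreal (exp (- cosh x / \<zeta> (Suc n))) \<partial>lborel)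
         = (\<lambda>\<zeta>. C * indicator {0<..} (\<zeta> (Suc n)) * (\<integral>\<^sup>+z'. (\<integral>\<^sup>+x. H (\<zeta>(Suc (Suc n) := z'), x)
             * ennreal (exp (- cosh x / (\<zeta>(Suc (Suc n) := z')) (Suc (Suc n)))) \<partial>lborel) * \<kappa> (\<zeta> (Suc n)) z' \<partial>lborel))"
      proof
        fix \<zeta> :: "nat \<Rightarrow> real"
        show "(\<integral>\<^sup>+x. H' (\<zeta>, x) * ennreal (exp (- cosh x / \<zeta> (Suc n))) \<partial>lborel)
         = C * indicator {0<..} (\<zeta> (Suc n)) * (\<integral>\<^sup>+z'. (\<integral>\<^sup>+x. H (\<zeta>(Suc (Suc n) := z'), x)
             * ennreal (exp (- cosh x / (\<zeta>(Suc (Suc n) := z')) (Suc (Suc n)))) \<partial>lborel) * \<kappa> (\<zeta> (Suc n)) z' \<partial>lborel)"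
        proof (cases "\<zeta> (Suc n) > 0")
          case False
          then show ?thesis by (simp add: H'_def)
        next
          case True
          define G where "G = (\<lambda>(z', x'). H (\<zeta>(Suc (Suc n) := z'), x'))"
          have G: "G \<in> borel_measurable (borel \<Otimes>\<^sub>M borel)"
            unfolding G_def by (rule measurable_fun_upd_section[OF H])
          have "(\<integral>\<^sup>+x. H' (\<zeta>, x) * ennreal (exp (- cosh x / \<zeta> (Suc n))) \<partial>lborel)
            = (\<integral>\<^sup>+x. C * ((\<integral>\<^sup>+y. G (\<zeta> (Suc n) * exp (- y) + h * exp x, x + y)
              * ennreal (exp (- cosh y / h)) \<partial>lborel) * ennreal (exp (- cosh x / \<zeta> (Suc n)))) \<partial>lborel)"
            using True by (simp add: H'_def G_def mult.assoc)
          also have "\<dots> = C * (\<integral>\<^sup>+x. (\<integral>\<^sup>+y. G (\<zeta> (Suc n) * exp (- y) + h * exp x, x + y)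
              * ennreal (exp (- cosh y / h)) \<partial>lborel) * ennreal (exp (- cosh x / \<zeta> (Suc n))) \<partial>lborel)"
            by (rule nn_integral_cmult) (use G in measurable)
          finally show ?thesis
            unfolding nn_integral_cosh_step[OF G True h] using True
            by (simp add: G_def \<kappa>_def)
        qed
      qed
      finally show "(\<integral>\<^sup>+\<delta>. (\<Prod>i<Suc (Suc n). ennreal (cosh_weight h (\<delta> i))) * H (history h (Suc (Suc n)) \<delta>, walk \<delta> (Suc (Suc n)))
          \<partial>Pi\<^sub>M {..<Suc (Suc n)} (\<lambda>_. normal_measure h))
        = I (\<lambda>\<zeta>. C * indicator {0<..} (\<zeta> (Suc n)) * (\<integral>\<^sup>+z'. (\<integral>\<^sup>+x. H (\<zeta>(Suc (Suc n) := z'), x)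
             * ennreal (exp (- cosh x / (\<zeta>(Suc (Suc n) := z')) (Suc (Suc n)))) \<partial>lborel) * \<kappa> (\<zeta> (Suc n)) z' \<partial>lborel))" .
    qed
  qed
qed

text \<open>One functional \<open>I\<close> serves both \<open>H\<close> and its reflection in the
  second argument, and the inner integrals agree because cosh is even and Lebesgue measure is
  invariant under reflection.\<close>

lemma cosh_walk_symmetry:
  assumes h: "h > 0" and n: "n > 0"
    and H [measurable]: "H \<in> borel_measurable (Pi\<^sub>M UNIV (\<lambda>_. borel) \<Otimes>\<^sub>M borel)"
  shows "(\<integral>\<^sup>+\<delta>. (\<Prod>i<n. ennreal (cosh_weight h (\<delta> i))) * H (history h n \<delta>, - walk \<delta> n)
            \<partial>Pi\<^sub>M {..<n} (\<lambda>_. normal_measure h))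
       = (\<integral>\<^sup>+\<delta>. (\<Prod>i<n. ennreal (cosh_weight h (\<delta> i))) * H (history h n \<delta>, walk \<delta> n)
            \<partial>Pi\<^sub>M {..<n} (\<lambda>_. normal_measure h))"
proof -
  obtain m where m: "n = Suc m" using n by (cases n) auto
  obtain I :: "((nat \<Rightarrow> real) \<Rightarrow> ennreal) \<Rightarrow> ennreal" where
      I: "\<And>H. H \<in> borel_measurable (Pi\<^sub>M UNIV (\<lambda>_. borel) \<Otimes>\<^sub>M borel) \<Longrightarrow>
      (\<integral>\<^sup>+\<delta>. (\<Prod>i<Suc m. ennreal (cosh_weight h (\<delta> i))) * H (history h (Suc m) \<delta>, walk \<delta> (Suc m))
          \<partial>Pi\<^sub>M {..<Suc m} (\<lambda>_. normal_measure h))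
      = I (\<lambda>\<zeta>. \<integral>\<^sup>+x. H (\<zeta>, x) * ennreal (exp (- cosh x / \<zeta> (Suc m))) \<partial>lborel)"
    using cosh_walk_disintegration[OF h, of m] by blast
  have flip_meas: "(\<lambda>(\<zeta>, x). H (\<zeta>, - x)) \<in> borel_measurable (Pi\<^sub>M UNIV (\<lambda>_. borel) \<Otimes>\<^sub>M borel)"
    by measurable
  have "(\<integral>\<^sup>+x. H (\<zeta>, - x) * ennreal (exp (- cosh x / \<zeta> (Suc m))) \<partial>lborel)
      = (\<integral>\<^sup>+x. H (\<zeta>, x) * ennreal (exp (- cosh x / \<zeta> (Suc m))) \<partial>lborel)" for \<zeta>
  proof -
    have "\<zeta> \<in> space (Pi\<^sub>M UNIV (\<lambda>_. borel))" by (simp add: space_PiM)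
    then have "(\<lambda>x. H (\<zeta>, x) * ennreal (exp (- cosh x / \<zeta> (Suc m)))) \<in> borel_measurable borel"
      by measurable
    from nn_integral_real_affine[OF this, of "- 1" 0] show ?thesis by simp
  qed
  then show ?thesis
    using I[OF flip_meas] I[OF H] by (simp add: m del: walk_Suc prod.lessThan_Suc)
qed

subsection \<open>Comparison with Gaussian steps\<close>

text \<open>In the mean of the expansions of exp x and exp (- x) the odd terms cancel, and the
  remainder is a nonnegative multiple of x^4. For |x| \<le> 1 its coefficient is at most (3 + 3) /
  48, crudely bounded by 1.\<close>

lemma cosh_taylor:
  fixes x :: real
  shows "1 + x\<^sup>2 / 2 \<le> cosh x" and "\<bar>x\<bar> \<le> 1 \<Longrightarrow> cosh x \<le> 1 + x\<^sup>2 / 2 + x ^ 4"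
proof -
  obtain s where s: "\<bar>s\<bar> \<le> \<bar>x\<bar>" "exp x = (\<Sum>m<4. x ^ m / fact m) + exp s / fact 4 * x ^ 4"
    using Maclaurin_exp_le by blast
  obtain r where r: "\<bar>r\<bar> \<le> \<bar>- x\<bar>" "exp (- x) = (\<Sum>m<4. (- x) ^ m / fact m) + exp r / fact 4 * (- x) ^ 4"
    using Maclaurin_exp_le by blast
  have eq: "cosh x = 1 + x\<^sup>2 / 2 + (exp s + exp r) / 48 * x ^ 4"
    unfolding cosh_field_def s r
    by (simp add: eval_nat_numeral fact_numeral field_simps)
  show "1 + x\<^sup>2 / 2 \<le> cosh x" unfolding eq by simp
  assume x: "\<bar>x\<bar> \<le> 1"
  have "exp s \<le> 3" "exp r \<le> 3"
    using s(1) r(1) x exp_le order_trans[of "exp s" "exp 1" 3] order_trans[of "exp r" "exp 1" 3] by auto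
  then have "(exp s + exp r) / 48 \<le> 1" by simp
  then have "(exp s + exp r) / 48 * x ^ 4 \<le> 1 * x ^ 4"
    by (intro mult_right_mono) auto
  then show "cosh x \<le> 1 + x\<^sup>2 / 2 + x ^ 4" unfolding eq by simp
qed

lemma cosh_weight_pos: "0 < cosh_weight h x"
  by (simp add: cosh_weight_def)

lemma cosh_weight_le_1: "h > 0 \<Longrightarrow> cosh_weight h x \<le> 1"
  using cosh_taylor(1)[of x] by (simp add: cosh_weight_def divide_nonpos_pos)

text \<open>Near 0 this is the Taylor bound together with 1 - exp (- u) \<le> u. For |x| > 1 the
  left side is at most 1 and h \<le> 1 makes the right side at least 1. A single monomial valid on
  the whole line reduces the mean-square deviation to a Gaussian moment.\<close>

lemma cosh_weight_deficit:
  assumes h: "0 < h" "h \<le> 1"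
  shows "(1 - cosh_weight h x)\<^sup>2 \<le> x ^ 8 / h\<^sup>2"
proof (cases "\<bar>x\<bar> \<le> 1")
  case True
  define u where "u = (cosh x - 1 - x\<^sup>2 / 2) / h"
  have "u \<le> x ^ 4 / h"
    unfolding u_def using cosh_taylor(2)[OF True] h by (intro divide_right_mono) auto
  moreover have "1 - cosh_weight h x \<le> u"
  proof -
    have "cosh_weight h x = exp (- u)" by (simp only: cosh_weight_def u_def minus_divide_left)
    then show ?thesis using exp_ge_add_one_self[of "- u"] by simp
  qed
  ultimately have "(1 - cosh_weight h x)\<^sup>2 \<le> (x ^ 4 / h)\<^sup>2"
    using cosh_weight_le_1[OF h(1), of x] by (intro power_mono) auto
  then show ?thesis by (simp add: power_divide flip: power_mult)
next
  case False
  have "(1 - cosh_weight h x)\<^sup>2 \<le> 1"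
    using cosh_weight_pos[of h x] cosh_weight_le_1[OF h(1), of x] by (intro power_le_one) auto
  also have "1 \<le> \<bar>x\<bar> ^ 8" using False by (intro one_le_power) auto
  also have "\<bar>x\<bar> ^ 8 = x ^ 8" by (simp add: power_even_abs)
  also have "x ^ 8 \<le> x ^ 8 / h\<^sup>2"
    using h power_le_one[of h 2] mult_right_mono[of "h\<^sup>2" 1 "x ^ 8"]
    by (simp add: pos_le_divide_eq mult.commute)
  finally show ?thesis .
qed

lemma integral_normal_measure:
  fixes f :: "real \<Rightarrow> real"
  assumes [measurable]: "f \<in> borel_measurable borel"
  shows "(\<integral>x. f x \<partial>normal_measure h) = (\<integral>x. normal_density 0 (sqrt h) x * f x \<partial>lborel)"
    and "integrable (normal_measure h) f \<longleftrightarrow> integrable lborel (\<lambda>x. normal_density 0 (sqrt h) x * f x)"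
  by (auto simp: integral_density integrable_density)

text \<open>Let a be the mean square of 1 - w for the weight w. The eighth moment of the normal law
  is 7 * 5 * 3 * h^4 = 105 h^4, whence a \<le> 105 h^2. The bound h \<le> 1 / 21 forces a \<le> 1 /
  4, and this gives K \<ge> 1 / 2. The variance of w is at most a, and division by K^2 \<ge> 1 / 4
  turns 105 into 420.\<close>

lemma cosh_weight_moments:
  assumes h: "0 < h" "h \<le> 1 / 21"
  defines "K \<equiv> \<integral>x. cosh_weight h x \<partial>normal_measure h"
  shows "K > 0" and "(\<integral>x. (cosh_weight h x)\<^sup>2 \<partial>normal_measure h) / K\<^sup>2 \<le> 1 + 420 * h\<^sup>2"
proof -
  interpret N: prob_space "normal_measure h"
    using h by (intro prob_space_normal_density) simp
  have [simp]: "N.prob UNIV = 1" using N.prob_space by simp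
  let ?w = "cosh_weight h"
  define K2 where "K2 = (\<integral>x. (?w x)\<^sup>2 \<partial>normal_measure h)"
  define a where "a = (\<integral>x. (1 - ?w x)\<^sup>2 \<partial>normal_measure h)"
  have bnd: "0 < ?w x" "?w x \<le> 1" for x
    using cosh_weight_pos cosh_weight_le_1 h by auto
  have int_w: "integrable (normal_measure h) ?w"
    by (rule N.integrable_const_bound[of _ 1]) (use bnd in \<open>auto simp: less_imp_le\<close>)
  have int_w2: "integrable (normal_measure h) (\<lambda>x. (?w x)\<^sup>2)"
    by (rule N.integrable_const_bound[of _ 1]) (use bnd in \<open>auto simp: less_imp_le power_le_one\<close>)
  have a_eq: "a = 1 - 2 * K + K2"
    unfolding a_def K2_def K_def power2_diff using int_w int_w2 by (simp add: N.prob_space)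
  have int_d: "integrable (normal_measure h) (\<lambda>x. (1 - ?w x)\<^sup>2)"
    unfolding power2_diff using int_w int_w2 by simp
  have mom: "has_bochner_integral lborel (\<lambda>x. normal_density 0 (sqrt h) x * x ^ 8) (105 * h ^ 4)"
    using normal_moment_even[of "sqrt h" 0 4] h
    by (simp add: fact_numeral power_divide)
  have "a \<le> (\<integral>x. x ^ 8 / h\<^sup>2 \<partial>normal_measure h)"
    unfolding a_def using cosh_weight_deficit[of h] h mom
    by (intro integral_mono int_d) (auto simp: integral_normal_measure has_bochner_integral_iff)
  also have "\<dots> = 105 * h ^ 4 / h\<^sup>2"
    using mom by (simp add: integral_normal_measure has_bochner_integral_iff)
  also have "\<dots> = 105 * h\<^sup>2" using h by (simp add: eval_nat_numeral)
  finally have a_le: "a \<le> 105 * h\<^sup>2" .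
  have "h\<^sup>2 \<le> (1 / 21)\<^sup>2" using h by (intro power_mono) auto
  then have a_le': "a \<le> 1 / 4" using a_le by (simp add: power2_eq_square)
  have "1 - K \<le> 1 / 4 + a"
  proof -
    \<comment> \<open>Integrating this pointwise inequality bounds 1 - K by the mean square without
      Cauchy-Schwarz.\<close>
    have le: "1 - u \<le> 1 / 4 + (1 - u)\<^sup>2" for u :: real
      using zero_le_power2[of "1 - u - 1 / 2"] by (simp add: power2_eq_square algebra_simps)
    have "(\<integral>x. 1 - ?w x \<partial>normal_measure h) \<le> (\<integral>x. 1 / 4 + (1 - ?w x)\<^sup>2 \<partial>normal_measure h)"
      using int_w int_d by (intro integral_mono le) auto
    then show ?thesis
      using int_w int_d by (simp add: K_def a_def N.prob_space)
  qed
  then have K: "K \<ge> 1 / 2" using a_le' by simp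
  then show "K > 0" by simp
  have K2: "K2 = K\<^sup>2 + a - (1 - K)\<^sup>2"
    unfolding a_eq by (simp add: power2_eq_square algebra_simps)
  have "(1/2)\<^sup>2 \<le> K\<^sup>2" using K by (intro power_mono) auto
  then have "420 * h\<^sup>2 * (1/4) \<le> 420 * h\<^sup>2 * K\<^sup>2" by (intro mult_left_mono) (auto simp: power2_eq_square)
  moreover have "K2 \<le> K\<^sup>2 + a" unfolding K2 by simp
  ultimately have "K2 \<le> K\<^sup>2 + 420 * h\<^sup>2 * K\<^sup>2" using a_le by linarith
  also have "\<dots> = (1 + 420 * h\<^sup>2) * K\<^sup>2" by (simp add: distrib_right)
  finally have "K2 \<le> (1 + 420 * h\<^sup>2) * K\<^sup>2" .
  then show "K2 / K\<^sup>2 \<le> 1 + 420 * h\<^sup>2"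
    using K by (simp add: pos_divide_le_eq)
qed

text \<open>By independence the product has mean K^n and mean square K2^n, where K2 is the second
  moment of the weight, so the mean square of the deviation is exactly (K2 / K^2)^n - 1.
  Nonnegativity of the variance leads from the mean square to the mean.\<close>

lemma cosh_weight_L1:
  assumes M: "prob_space M" and h: "0 < h" "h \<le> 1 / 21"
    and ind: "prob_space.indep_vars M (\<lambda>_. borel) \<Delta> {..<n}"
    and dist: "\<And>i. i < n \<Longrightarrow> distr M borel (\<Delta> i) = normal_measure h"
  defines "K \<equiv> \<integral>x. cosh_weight h x \<partial>normal_measure h"
  shows "(\<integral>\<omega>. \<bar>1 - (\<Prod>i<n. cosh_weight h (\<Delta> i \<omega>)) / K ^ n\<bar> \<partial>M) \<le> sqrt (exp (420 * real n * h\<^sup>2) - 1)"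
proof -
  interpret prob_space M by fact
  note K = cosh_weight_moments(1)[OF h, folded K_def] 
  let ?w = "cosh_weight h"
  define K2 where "K2 = (\<integral>x. (?w x)\<^sup>2 \<partial>normal_measure h)"
  define P where "P \<omega> = (\<Prod>i<n. ?w (\<Delta> i \<omega>))" for \<omega>
  have rv [measurable]: "\<Delta> i \<in> borel_measurable M" if "i < n" for i
    using ind that by (auto simp: indep_vars_def)
  have [measurable]: "P \<in> borel_measurable M"
    unfolding P_def by (intro borel_measurable_prod measurable_compose[OF _ borel_measurable_cosh_weight]) auto
  have bnd: "0 < ?w x" "?w x \<le> 1" for x
    using cosh_weight_pos cosh_weight_le_1 h by auto
  have P_bnd: "0 \<le> P \<omega>" "P \<omega> \<le> 1" for \<omega>
    unfolding P_def using bnd by (auto intro!: prod_nonneg prod_le_1 simp: less_imp_le)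
  have int_prod: "(\<integral>\<omega>. (\<Prod>i<n. f (\<Delta> i \<omega>)) \<partial>M) = (\<integral>x. f x \<partial>normal_measure h) ^ n"
    if f [measurable]: "f \<in> borel_measurable borel" and f_bnd: "\<And>x. \<bar>f x\<bar> \<le> 1" for f :: "real \<Rightarrow> real"
  proof -
    have "(\<integral>\<omega>. (\<Prod>i<n. f (\<Delta> i \<omega>)) \<partial>M) = (\<Prod>i<n. \<integral>\<omega>. f (\<Delta> i \<omega>) \<partial>M)"
    proof (intro indep_vars_lebesgue_integral)
      show "indep_vars (\<lambda>_. borel) (\<lambda>i \<omega>. f (\<Delta> i \<omega>)) {..<n}"
        using indep_vars_compose2[OF ind, of "\<lambda>_. f"] by simp
      show "integrable M (\<lambda>\<omega>. f (\<Delta> i \<omega>))" if "i \<in> {..<n}" for i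
        using that f_bnd by (intro integrable_const_bound[of _ 1]) auto
    qed auto
    also have "\<dots> = (\<Prod>i<n. \<integral>x. f x \<partial>distr M borel (\<Delta> i))"
      by (intro prod.cong) (auto simp: integral_distr)
    finally show ?thesis by (simp add: dist)
  qed
  have EP: "(\<integral>\<omega>. P \<omega> \<partial>M) = K ^ n"
    unfolding P_def K_def by (rule int_prod) (use bnd in \<open>auto simp: less_imp_le\<close>)
  have "(\<lambda>\<omega>. (P \<omega>)\<^sup>2) = (\<lambda>\<omega>. \<Prod>i<n. (?w (\<Delta> i \<omega>))\<^sup>2)"
    by (simp add: P_def prod_power_distrib)
  moreover have "(\<integral>\<omega>. (\<Prod>i<n. (?w (\<Delta> i \<omega>))\<^sup>2) \<partial>M) = K2 ^ n"
    unfolding K2_def by (rule int_prod) (use bnd in \<open>auto simp: less_imp_le power_le_one\<close>)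
  ultimately have EP2: "(\<integral>\<omega>. (P \<omega>)\<^sup>2 \<partial>M) = K2 ^ n" by simp
  have int_P: "integrable M P" "integrable M (\<lambda>\<omega>. (P \<omega>)\<^sup>2)"
    using P_bnd by (auto intro!: integrable_const_bound[of _ 1] simp: power_le_one)
  define Y where "Y \<omega> = \<bar>1 - P \<omega> / K ^ n\<bar>" for \<omega>
  have Y2: "(Y \<omega>)\<^sup>2 = 1 - 2 * (P \<omega> / K ^ n) + (P \<omega>)\<^sup>2 / (K ^ n)\<^sup>2" for \<omega>
    by (simp add: Y_def power2_diff power_divide)
  have int_Y: "integrable M Y" "integrable M (\<lambda>\<omega>. (Y \<omega>)\<^sup>2)"
    unfolding Y2 unfolding Y_def using int_P by auto
  have EY2: "(\<integral>\<omega>. (Y \<omega>)\<^sup>2 \<partial>M) = (K2 / K\<^sup>2) ^ n - 1"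
    unfolding Y2 using int_P K
    by (simp add: EP EP2 prob_space power_divide power_mult[symmetric] mult.commute)
  have "0 \<le> variance Y" by (rule variance_positive)
  then have "(\<integral>\<omega>. Y \<omega> \<partial>M)\<^sup>2 \<le> (\<integral>\<omega>. (Y \<omega>)\<^sup>2 \<partial>M)"
    using variance_eq[OF int_Y] by simp
  also have "\<dots> \<le> exp (420 * real n * h\<^sup>2) - 1"
  proof -
    have "(K2 / K\<^sup>2) ^ n \<le> (exp (420 * h\<^sup>2)) ^ n"
    proof (rule power_mono)
      have "K2 / K\<^sup>2 \<le> 1 + 420 * h\<^sup>2"
        using cosh_weight_moments(2)[OF h] by (simp add: K_def K2_def)
      also have "\<dots> \<le> exp (420 * h\<^sup>2)" by (rule exp_ge_add_one_self)
      finally show "K2 / K\<^sup>2 \<le> exp (420 * h\<^sup>2)" .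
      show "0 \<le> K2 / K\<^sup>2" unfolding K2_def by simp
    qed
    also have "\<dots> = exp (420 * real n * h\<^sup>2)"
      by (simp add: exp_of_nat_mult[symmetric] ac_simps)
    finally show ?thesis unfolding EY2 by simp
  qed
  finally have "(\<integral>\<omega>. Y \<omega> \<partial>M) \<le> sqrt (exp (420 * real n * h\<^sup>2) - 1)"
    by (rule real_le_rsqrt)
  then show ?thesis unfolding Y_def P_def .
qed

text \<open>Weighted with P, a multiple of the density of the cosh walk, the two expectations agree
  by \<open>cosh_walk_symmetry\<close>. Their unweighted difference is therefore the expectation of
  1 - P / K^n times a factor of modulus at most 1, and \<open>cosh_weight_L1\<close> bounds
  it.\<close>

lemma gaussian_walk_almost_symmetric:
  fixes H :: "(nat \<Rightarrow> real) \<times> real \<Rightarrow> real"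
  assumes M: "prob_space M" and h: "0 < h" "h \<le> 1 / 21" and n: "n > 0"
    and ind: "prob_space.indep_vars M (\<lambda>_. borel) \<Delta> {..<n}"
    and dist: "\<And>i. i < n \<Longrightarrow> distr M borel (\<Delta> i) = normal_measure h"
    and H [measurable]: "H \<in> borel_measurable (Pi\<^sub>M UNIV (\<lambda>_. borel) \<Otimes>\<^sub>M borel)"
    and H_bnd: "\<And>p. 0 \<le> H p" "\<And>p. H p \<le> 1"
  shows "\<bar>(\<integral>\<omega>. H (history h n (\<lambda>i. \<Delta> i \<omega>), - walk (\<lambda>i. \<Delta> i \<omega>) n) \<partial>M)
        - (\<integral>\<omega>. H (history h n (\<lambda>i. \<Delta> i \<omega>), walk (\<lambda>i. \<Delta> i \<omega>) n) \<partial>M)\<bar>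
       \<le> sqrt (exp (420 * real n * h\<^sup>2) - 1)"
proof -
  interpret prob_space M by fact
  define K where "K = (\<integral>x. cosh_weight h x \<partial>normal_measure h)"
  have K: "K > 0" using cosh_weight_moments(1)[OF h] by (simp add: K_def)
  let ?w = "cosh_weight h"
  define P where "P \<omega> = (\<Prod>i<n. ?w (\<Delta> i \<omega>))" for \<omega>
  define V where "V s \<omega> = H (history h n (\<lambda>i. \<Delta> i \<omega>), s * walk (\<lambda>i. \<Delta> i \<omega>) n)" for s \<omega>
  have rv [measurable]: "\<Delta> i \<in> borel_measurable M" if "i < n" for i
    using ind that by (auto simp: indep_vars_def)
  have P_meas [measurable]: "P \<in> borel_measurable M"
    unfolding P_def by (intro borel_measurable_prod measurable_compose[OF _ borel_measurable_cosh_weight]) auto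
  have bnd: "0 < ?w x" "?w x \<le> 1" for x
    using cosh_weight_pos cosh_weight_le_1 h by auto
  have P_bnd: "0 \<le> P \<omega>" "P \<omega> \<le> 1" for \<omega>
    unfolding P_def using bnd by (auto intro!: prod_nonneg prod_le_1 simp: less_imp_le)
  have [measurable]: "(\<lambda>\<omega>. walk (\<lambda>i. \<Delta> i \<omega>) n) \<in> borel_measurable M"
    by (rule measurable_walk) (rule rv)
  have [measurable]: "(\<lambda>\<omega>. history h n (\<lambda>i. \<Delta> i \<omega>)) \<in> measurable M (Pi\<^sub>M UNIV (\<lambda>_. borel))"
    by (rule measurable_history) (rule rv)
  have V_meas [measurable]: "V s \<in> borel_measurable M" for s
    unfolding V_def by measurable
  have V_bnd: "0 \<le> V s \<omega>" "V s \<omega> \<le> 1" for s \<omega>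
    using H_bnd by (auto simp: V_def)
  \<comment> \<open>The product measure lives on extensional functions, hence the restriction to
    {..<n}. Up to index n, \<open>walk\<close> and \<open>history\<close> see only these
    coordinates.\<close>
  define D where "D \<omega> = (\<lambda>i\<in>{..<n}. \<Delta> i \<omega>)" for \<omega>
  have [measurable]: "D \<in> measurable M (Pi\<^sub>M {..<n} (\<lambda>_. borel))"
    unfolding D_def by (rule measurable_restrict) auto
  have distr_D: "distr M (Pi\<^sub>M {..<n} (\<lambda>_. borel)) D = Pi\<^sub>M {..<n} (\<lambda>_. normal_measure h)"
  proof -
    have "{..<n} \<noteq> {}" using n by auto
    then have "distr M (Pi\<^sub>M {..<n} (\<lambda>_. borel)) D = Pi\<^sub>M {..<n} (\<lambda>i. distr M borel (\<Delta> i))"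
      using ind indep_vars_iff_distr_eq_PiM'[where I = "{..<n}" and M' = "\<lambda>_. borel" and X = \<Delta>] rv
      unfolding D_def[abs_def] by auto
    also have "\<dots> = Pi\<^sub>M {..<n} (\<lambda>_. normal_measure h)"
      by (intro PiM_cong) (auto simp: dist)
    finally show ?thesis .
  qed
  have EPV: "(\<integral>\<^sup>+\<omega>. ennreal (P \<omega> * V s \<omega>) \<partial>M) =
      (\<integral>\<^sup>+\<delta>. (\<Prod>i<n. ennreal (cosh_weight h (\<delta> i))) * ennreal (H (history h n \<delta>, s * walk \<delta> n))
            \<partial>Pi\<^sub>M {..<n} (\<lambda>_. normal_measure h))" for s
  proof -
    have comp: "(\<lambda>\<delta>. \<delta> i) \<in> borel_measurable (Pi\<^sub>M {..<n} (\<lambda>_. borel :: real measure))" if "i < n" for i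
      using that by (intro measurable_component_singleton) auto
    have [measurable]: "(\<lambda>\<delta>. walk \<delta> n) \<in> borel_measurable (Pi\<^sub>M {..<n} (\<lambda>_. borel :: real measure))"
      by (intro measurable_walk comp)
    have [measurable]: "(\<lambda>\<delta>. history h n \<delta>) \<in> measurable (Pi\<^sub>M {..<n} (\<lambda>_. borel)) (Pi\<^sub>M UNIV (\<lambda>_. borel))"
      by (intro measurable_history comp)
    have [measurable]: "(\<lambda>\<delta>. \<Prod>i<n. ennreal (?w (\<delta> i))) \<in> borel_measurable (Pi\<^sub>M {..<n} (\<lambda>_. borel))"
      by (intro borel_measurable_prod_ennreal measurable_compose[OF _ measurable_ennreal]
          measurable_compose[OF _ borel_measurable_cosh_weight] comp) auto
    have eqs: "walk (D \<omega>) n = walk (\<lambda>i. \<Delta> i \<omega>) n" "history h n (D \<omega>) = history h n (\<lambda>i. \<Delta> i \<omega>)" for \<omega>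
    proof -
      have w: "walk (D \<omega>) k = walk (\<lambda>i. \<Delta> i \<omega>) k" if "k \<le> n" for k
        using that by (intro walk_cong) (auto simp: D_def)
      have "expsum h (D \<omega>) k = expsum h (\<lambda>i. \<Delta> i \<omega>) k" if "k \<le> n" for k
        using that by (intro expsum_cong) (auto simp: D_def)
      with w show "walk (D \<omega>) n = walk (\<lambda>i. \<Delta> i \<omega>) n" "history h n (D \<omega>) = history h n (\<lambda>i. \<Delta> i \<omega>)"
        by (auto simp: history_def ratio_def)
    qed
    have eqP: "(\<Prod>i<n. ennreal (?w (D \<omega> i))) = ennreal (P \<omega>)" for \<omega>
      by (simp add: P_def D_def prod_ennreal)
    show ?thesis unfolding distr_D[symmetric]
      by (subst nn_integral_distr, measurable)
        (auto intro!: nn_integral_cong simp: eqP V_def eqs ennreal_mult P_bnd H_bnd)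
  qed
  have eq: "(\<integral>\<omega>. P \<omega> * V (- 1) \<omega> \<partial>M) = (\<integral>\<omega>. P \<omega> * V 1 \<omega> \<partial>M)"
  proof -
    have "(\<integral>\<^sup>+\<omega>. ennreal (P \<omega> * V (- 1) \<omega>) \<partial>M) = (\<integral>\<^sup>+\<omega>. ennreal (P \<omega> * V 1 \<omega>) \<partial>M)"
      unfolding EPV using cosh_walk_symmetry[OF h(1) n, of "\<lambda>p. ennreal (H p)"] by simp
    then show ?thesis
      using P_bnd V_bnd by (subst (1 2) integral_eq_nn_integral) auto
  qed
  have int_P: "integrable M P"
    using P_bnd by (intro integrable_const_bound[of _ 1]) auto
  have int_V: "integrable M (V s)" for s
    using V_bnd by (intro integrable_const_bound[of _ 1]) auto
  have int_PV: "integrable M (\<lambda>\<omega>. P \<omega> * V s \<omega>)" for s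
    using P_bnd V_bnd by (intro integrable_const_bound[of _ 1]) (auto intro!: mult_le_one)
  have "(\<integral>\<omega>. V (- 1) \<omega> \<partial>M) - (\<integral>\<omega>. V 1 \<omega> \<partial>M)
      = (\<integral>\<omega>. (1 - P \<omega> / K ^ n) * (V (- 1) \<omega> - V 1 \<omega>) \<partial>M)"
  proof -
    have "(\<integral>\<omega>. (1 - P \<omega> / K ^ n) * (V (- 1) \<omega> - V 1 \<omega>) \<partial>M)
       = (\<integral>\<omega>. V (- 1) \<omega> - V 1 \<omega> - (P \<omega> * V (- 1) \<omega> - P \<omega> * V 1 \<omega>) / K ^ n \<partial>M)"
      by (intro Bochner_Integration.integral_cong) (auto simp: algebra_simps diff_divide_distrib)
    then show ?thesis using int_V int_PV by (simp add: eq)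
  qed
  also have "\<bar>\<dots>\<bar> \<le> (\<integral>\<omega>. \<bar>(1 - P \<omega> / K ^ n) * (V (- 1) \<omega> - V 1 \<omega>)\<bar> \<partial>M)"
    by (rule integral_abs_bound)
  also have "\<dots> \<le> (\<integral>\<omega>. \<bar>1 - P \<omega> / K ^ n\<bar> \<partial>M)"
  proof (rule integral_mono)
    have le: "\<bar>(1 - P \<omega> / K ^ n) * (V (- 1) \<omega> - V 1 \<omega>)\<bar> \<le> \<bar>1 - P \<omega> / K ^ n\<bar>" for \<omega>
    proof -
      have "\<bar>V (- 1) \<omega> - V 1 \<omega>\<bar> \<le> 1" using V_bnd[of "- 1" \<omega>] V_bnd[of 1 \<omega>] by linarith
      then show ?thesis unfolding abs_mult by (rule mult_left_le) simp
    qed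
    then show "\<bar>(1 - P \<omega> / K ^ n) * (V (- 1) \<omega> - V 1 \<omega>)\<bar> \<le> \<bar>1 - P \<omega> / K ^ n\<bar>" for \<omega> .
    show int1: "integrable M (\<lambda>\<omega>. \<bar>1 - P \<omega> / K ^ n\<bar>)" using int_P by auto
    show "integrable M (\<lambda>\<omega>. \<bar>(1 - P \<omega> / K ^ n) * (V (- 1) \<omega> - V 1 \<omega>)\<bar>)"
      by (rule Bochner_Integration.integrable_bound[OF int1]) (use le in auto)
  qed
  also have "\<dots> \<le> sqrt (exp (420 * real n * h\<^sup>2) - 1)"
    using cosh_weight_L1[OF M h ind dist] by (simp add: P_def K_def)
  finally show ?thesis by (simp add: V_def)
qed

subsection \<open>Riemann sums along a path\<close>

text \<open>The exact discrete form of d (1 / A) = - ds / Z^2: divide A_{j+1} - A_j = h * exp (X_j +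
  X_{j+1}) by A_j * A_{j+1} and distribute the two exponentials over the two factors of the
  denominator.\<close>

lemma inverse_expsum_telescope:
  assumes h: "h > 0" and k: "1 \<le> k" "k \<le> n"
  shows "1 / expsum h \<delta> k = 1 / expsum h \<delta> n + (\<Sum>j=k..<n. h / (ratio h \<delta> j * ratio h \<delta> (Suc j)))"
  using k(2)
proof (induction n rule: dec_induct)
  case base
  then show ?case by simp
next
  case (step n)
  have pos: "expsum h \<delta> n > 0" "expsum h \<delta> (Suc n) > 0"
    using expsum_pos[OF h] step k by auto
  have "h / (ratio h \<delta> n * ratio h \<delta> (Suc n))
      = h * exp (walk \<delta> n + walk \<delta> (Suc n)) / (expsum h \<delta> n * expsum h \<delta> (Suc n))"
  proof -
    have "h / ((a * exp (- x)) * (c * exp (- y))) = h * exp (x + y) / (a * c)" for a c x y :: real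
      by (simp add: exp_minus exp_add field_simps)
    then show ?thesis unfolding ratio_def .
  qed
  also have "h * exp (walk \<delta> n + walk \<delta> (Suc n)) = expsum h \<delta> (Suc n) - expsum h \<delta> n"
    by (simp add: expsum_def algebra_simps)
  also have "\<dots> / (expsum h \<delta> n * expsum h \<delta> (Suc n)) = 1 / expsum h \<delta> n - 1 / expsum h \<delta> (Suc n)"
    using pos by (simp add: field_simps)
  finally show ?case using step by simp
qed

text \<open>Rebuilds 1 / A_k from the ratios and the end point, which enters only in the first
  summand.\<close>

definition recip :: "real \<Rightarrow> nat \<Rightarrow> nat \<Rightarrow> (nat \<Rightarrow> real) \<times> real \<Rightarrow> real" where
  "recip h n k p = exp (- snd p) / fst p n + (\<Sum>j=k..<n. h / (fst p j * fst p (Suc j)))"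

text \<open>Negating the end point turns exp (- X_n) / Z_n = 1 / A_n into exp (X_n) / Z_n = exp (2
  X_n) / A_n and leaves the sum over the ratios alone. This is the transformation of the
  theorem.\<close>

lemma recip_history:
  assumes h: "h > 0" and k: "1 \<le> k" "k \<le> n"
  shows "recip h n k (history h n \<delta>, walk \<delta> n) = 1 / expsum h \<delta> k"
    and "recip h n k (history h n \<delta>, - walk \<delta> n)
       = 1 / expsum h \<delta> k + exp (2 * walk \<delta> n) / expsum h \<delta> n - 1 / expsum h \<delta> n"
proof -
  have "exp (- x) / ratio h \<delta> n = exp (walk \<delta> n - x) / expsum h \<delta> n" for x
    by (simp add: ratio_def exp_minus exp_diff field_simps)
  from this[of "walk \<delta> n"] this[of "- walk \<delta> n"]
  have 1: "exp (- walk \<delta> n) / ratio h \<delta> n = 1 / expsum h \<delta> n"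
    "exp (walk \<delta> n) / ratio h \<delta> n = exp (2 * walk \<delta> n) / expsum h \<delta> n" by simp_all
  have "(\<Sum>j=k..<n. h / (history h n \<delta> j * history h n \<delta> (Suc j)))
      = 1 / expsum h \<delta> k - 1 / expsum h \<delta> n"
    using inverse_expsum_telescope[OF h k, of \<delta>] k by (simp add: history_def)
  moreover have "history h n \<delta> n = ratio h \<delta> n"
    using k by (simp add: history_def)
  ultimately show "recip h n k (history h n \<delta>, walk \<delta> n) = 1 / expsum h \<delta> k"
    "recip h n k (history h n \<delta>, - walk \<delta> n)
       = 1 / expsum h \<delta> k + exp (2 * walk \<delta> n) / expsum h \<delta> n - 1 / expsum h \<delta> n"
    unfolding recip_def using 1 by simp_all
qed

lemma measurable_recip [measurable]:
  "recip h n k \<in> borel_measurable (Pi\<^sub>M UNIV (\<lambda>_. borel) \<Otimes>\<^sub>M borel)"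
proof -
  have [measurable]: "(\<lambda>p. fst p j) \<in> borel_measurable (Pi\<^sub>M UNIV (\<lambda>_. borel) \<Otimes>\<^sub>M (borel :: real measure))"
    for j :: nat
    by (rule measurable_compose[OF measurable_fst measurable_component_singleton]) simp
  show ?thesis unfolding recip_def[abs_def] by measurable
qed

definition grid_increment :: "(real \<Rightarrow> real) \<Rightarrow> real \<Rightarrow> nat \<Rightarrow> real" where
  "grid_increment b h i = b (real (Suc i) * h) - b (real i * h)"

text \<open>Rounding up keeps the index at least 1 for s > 0, away from index 0 where
  \<open>expsum\<close> vanishes and has no reciprocal.\<close>

definition grid_index :: "real \<Rightarrow> nat \<Rightarrow> real \<Rightarrow> nat" where
  "grid_index t n s = nat \<lceil>s * real n / t\<rceil>"

lemma walk_grid_increment: "b 0 = 0 \<Longrightarrow> walk (grid_increment b h) k = b (real k * h)"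
  by (induction k) (simp_all add: grid_increment_def)

lemma grid_index_bounds:
  assumes "0 < s" "s \<le> t" "0 < n"
  shows "1 \<le> grid_index t n s" "grid_index t n s \<le> n"
    "s \<le> real (grid_index t n s) * (t / real n)" "real (grid_index t n s) * (t / real n) \<le> s + t / real n"
proof -
  have pos: "0 < s * real n / t" using assms by simp
  then have "1 \<le> \<lceil>s * real n / t\<rceil>" by linarith
  then show "1 \<le> grid_index t n s" unfolding grid_index_def by linarith
  have "s * real n / t \<le> real n" using assms by (simp add: divide_le_eq mult_right_mono)
  then have "\<lceil>s * real n / t\<rceil> \<le> int n" by linarith
  then show "grid_index t n s \<le> n" unfolding grid_index_def by linarith
  have eq: "real (grid_index t n s) = real_of_int \<lceil>s * real n / t\<rceil>"
    using pos by (simp add: grid_index_def)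
  have lo: "s * real n / t \<le> real (grid_index t n s)" unfolding eq by linarith
  have hi: "real (grid_index t n s) \<le> s * real n / t + 1" unfolding eq by linarith
  have c: "s = (s * real n / t) * (t / real n)" using assms by simp
  show "s \<le> real (grid_index t n s) * (t / real n)"
    by (subst c, rule mult_right_mono[OF lo]) (use assms in auto)
  have "real (grid_index t n s) * (t / real n) \<le> (s * real n / t + 1) * (t / real n)"
    by (rule mult_right_mono[OF hi]) (use assms in auto)
  also have "\<dots> = s + t / real n" using assms by (simp add: field_simps)
  finally show "real (grid_index t n s) * (t / real n) \<le> s + t / real n" .
qed

lemma grid_index_self: "t > 0 \<Longrightarrow> grid_index t n t = n"
  by (simp add: grid_index_def)

lemma grid_index_tendsto:
  assumes "0 < s" "s \<le> t"
  shows "(\<lambda>n. real (grid_index t n s) * (t / real n)) \<longlonglongrightarrow> s"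
proof (rule tendsto_sandwich)
  show "\<forall>\<^sub>F n in sequentially. s \<le> real (grid_index t n s) * (t / real n)"
    "\<forall>\<^sub>F n in sequentially. real (grid_index t n s) * (t / real n) \<le> s + t / real n"
    using grid_index_bounds(3,4)[OF assms] by (auto simp: eventually_sequentially intro!: exI[of _ 1])
  have "(\<lambda>n. s + t / real n) \<longlonglongrightarrow> s + 0" by (intro tendsto_intros lim_const_over_n)
  then show "(\<lambda>n. s + t / real n) \<longlonglongrightarrow> s" by simp
qed simp

text \<open>The error is estimated cell by cell. In \<open>osc\<close>, u and v stand for the end
  points of a cell and x for a point inside it, so that the geometric mean is compared with the
  integrand.\<close>

lemma expsum_riemann_error:
  fixes b :: "real \<Rightarrow> real"
  assumes b: "continuous_on {0..t} b" "b 0 = 0" and h: "h > 0" and T: "real n * h \<le> t"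
    and osc: "\<And>u v x. u \<in> {0..t} \<Longrightarrow> v \<in> {0..t} \<Longrightarrow> x \<in> {0..t} \<Longrightarrow> \<bar>u - x\<bar> \<le> h \<Longrightarrow> \<bar>v - x\<bar> \<le> h \<Longrightarrow>
      \<bar>exp (b u + b v) - exp (2 * b x)\<bar> \<le> e"
  shows "\<bar>expsum h (grid_increment b h) n - integral {0..real n * h} (\<lambda>u. exp (2 * b u))\<bar> \<le> e * (real n * h)"
  using T
proof (induction n)
  case 0
  then show ?case by (simp add: expsum_def)
next
  case (Suc n)
  let ?f = "\<lambda>u. exp (2 * b u)" and ?p = "real n * h" and ?q = "real (Suc n) * h"
  have pq: "0 \<le> ?p" "?p \<le> ?q" "?q \<le> t" "?q = ?p + h"
    using h Suc.prems by (auto simp: algebra_simps)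
  have cont: "continuous_on {0..t} ?f" by (intro continuous_intros b)
  have cont1: "continuous_on {0..?q} ?f" and cont2: "continuous_on {?p..?q} ?f"
    by (rule continuous_on_subset[OF cont]; use pq in auto)+
  have split: "integral {0..?q} ?f = integral {0..?p} ?f + integral {?p..?q} ?f"
    using pq by (intro Henstock_Kurzweil_Integration.integral_combine[symmetric] integrable_continuous_real cont1) auto
  define c where "c = exp (b ?p + b ?q)"
  have "norm (integral {?p..?q} (\<lambda>u. c - ?f u)) \<le> e * (?q - ?p)"
  proof (rule integral_bound)
    show "continuous_on {?p..?q} (\<lambda>u. c - ?f u)" by (intro continuous_intros cont2)
    show "norm (c - ?f u) \<le> e" if "u \<in> {?p..?q}" for u
    proof -
      have "u \<in> {0..t}" "?p \<in> {0..t}" "?q \<in> {0..t}" "\<bar>?p - u\<bar> \<le> h" "\<bar>?q - u\<bar> \<le> h"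
        using that pq unfolding atLeastAtMost_iff by linarith+
      then show ?thesis unfolding c_def real_norm_def by (intro osc)
    qed
  qed (use pq in auto)
  also have "integral {?p..?q} (\<lambda>u. c - ?f u) = integral {?p..?q} (\<lambda>_. c) - integral {?p..?q} ?f"
    by (intro Henstock_Kurzweil_Integration.integral_diff integrable_const_ivl
        integrable_continuous_real cont2)
  also have "integral {?p..?q} (\<lambda>_. c) = h * c" using pq by simp
  finally have cell: "\<bar>h * c - integral {?p..?q} ?f\<bar> \<le> e * h" using pq by simp
  have "expsum h (grid_increment b h) (Suc n) = expsum h (grid_increment b h) n + h * c"
    by (simp add: expsum_def c_def walk_grid_increment[of b, OF b(2)] distrib_left del: walk_Suc)
  moreover have "\<bar>expsum h (grid_increment b h) n - integral {0..?p} ?f\<bar> \<le> e * ?p"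
    using pq by (intro Suc.IH) auto
  moreover have "e * ?q = e * ?p + e * h" using pq by (simp only: distrib_left)
  ultimately show ?case using cell unfolding split by linarith
qed

lemma expsum_tendsto_integral:
  fixes b :: "real \<Rightarrow> real"
  assumes b: "continuous_on {0..t} b" "b 0 = 0" and s: "0 < s" "s \<le> t"
  shows "(\<lambda>n. expsum (t / real n) (grid_increment b (t / real n)) (grid_index t n s))
     \<longlonglongrightarrow> integral {0..s} (\<lambda>u. exp (2 * b u))"
proof -
  let ?F = "\<lambda>x. integral {0..x} (\<lambda>u. exp (2 * b u))"
  let ?x = "\<lambda>n. real (grid_index t n s) * (t / real n)"
  let ?E = "\<lambda>n. expsum (t / real n) (grid_increment b (t / real n)) (grid_index t n s)"
  have t: "t > 0" using s by simp
  have "continuous_on {0..t} ?F"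
    by (intro indefinite_integral_continuous_1 integrable_continuous_real continuous_intros b)
  then have lim_F: "(\<lambda>n. ?F (?x n)) \<longlonglongrightarrow> ?F s"
  proof (rule continuous_on_tendsto_compose[OF _ grid_index_tendsto[OF s]])
    show "\<forall>\<^sub>F n in sequentially. ?x n \<in> {0..t}"
    proof (rule eventually_sequentiallyI[of 1])
      fix n :: nat assume n: "1 \<le> n"
      have "?x n \<le> real n * (t / real n)"
        using grid_index_bounds(2)[OF s, of n] n t by (intro mult_right_mono) auto
      then show "?x n \<in> {0..t}" using n t by simp
    qed
  qed (use s in auto)
  have "(\<lambda>n. ?E n - ?F (?x n)) \<longlonglongrightarrow> 0"
  proof (rule LIMSEQ_I)
    fix r :: real assume r: "0 < r"
    define e where "e = r / (2 * t)"
    have e: "e > 0" using r t by (simp add: e_def)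
    \<comment> \<open>A cell contributes the value of \<open>g\<close> at its pair of end points,
      and the integrand is \<open>g\<close> on the diagonal. The two arguments are at distance at
      most 2 * h, so uniform continuity on the square applies once n exceeds 2 * t / d.\<close>
    define g where "g = (\<lambda>p. exp (b (fst p) + b (snd p)))"
    have "continuous_on ({0..t} \<times> {0..t}) g"
      unfolding g_def by (intro continuous_intros continuous_on_compose2[OF b(1)]) auto
    then have "uniformly_continuous_on ({0..t} \<times> {0..t}) g"
      by (intro compact_uniformly_continuous compact_Times) auto
    then obtain d where d: "d > 0"
      "\<And>p q. p \<in> {0..t} \<times> {0..t} \<Longrightarrow> q \<in> {0..t} \<times> {0..t} \<Longrightarrow> dist q p < d \<Longrightarrow> dist (g q) (g p) < e"
      using e unfolding uniformly_continuous_on_def by metis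
    obtain N :: nat where N: "2 * t / d < real N" using reals_Archimedean2 by blast
    show "\<exists>no. \<forall>n\<ge>no. norm (?E n - ?F (?x n) - 0) < r"
    proof (intro exI[of _ "Suc N"] allI impI)
      fix n assume n: "Suc N \<le> n"
      define h where "h = t / real n"
      have h: "h > 0" using t n by (simp add: h_def)
      have "2 * t / d < real n" using N n by simp
      then have hd: "2 * h < d" using d(1) n by (simp add: h_def field_simps)
      have xt: "?x n \<le> t"
      proof -
        have "?x n \<le> real n * (t / real n)"
          using grid_index_bounds(2)[OF s, of n] n t by (intro mult_right_mono) auto
        then show ?thesis using n by simp
      qed
      have "\<bar>?E n - ?F (?x n)\<bar> \<le> e * ?x n"
        unfolding h_def[symmetric]
      proof (rule expsum_riemann_error[OF b h])
        show "real (grid_index t n s) * h \<le> t" using xt by (simp add: h_def)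
        fix u v x assume uvx: "u \<in> {0..t}" "v \<in> {0..t}" "x \<in> {0..t}" "\<bar>u - x\<bar> \<le> h" "\<bar>v - x\<bar> \<le> h"
        have "dist (u, v) (x, x) \<le> \<bar>u - x\<bar> + \<bar>v - x\<bar>"
          unfolding dist_Pair_Pair by (simp add: dist_real_def sqrt_sum_squares_le_sum_abs[of "u - x" "v - x"])
        then have "dist (u, v) (x, x) < d" using uvx hd by linarith
        then have "dist (g (u, v)) (g (x, x)) < e" using uvx by (intro d) auto
        then show "\<bar>exp (b u + b v) - exp (2 * b x)\<bar> \<le> e" by (simp add: g_def dist_real_def)
      qed
      also have "e * ?x n \<le> e * t" using xt e by (intro mult_left_mono) auto
      also have "e * t < r" using r t by (simp add: e_def)
      finally show "norm (?E n - ?F (?x n) - 0) < r" by simp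
    qed
  qed
  from tendsto_add[OF this lim_F] show ?thesis by simp
qed

subsection \<open>The limit for Brownian motion\<close>

lemma grid_increment_brownian:
  assumes bm: "standard_brownian_motion M B" and h: "h > 0"
  shows "prob_space.indep_vars M (\<lambda>_. borel) (\<lambda>i \<omega>. grid_increment (\<lambda>s. B s \<omega>) h i) {..<n}"
    and "distr M borel (\<lambda>\<omega>. grid_increment (\<lambda>s. B s \<omega>) h i) = normal_measure h"
proof -
  have mono: "real i * h \<le> real (Suc i) * h" if "i < n" for i
    by (rule mult_right_mono) (use h in auto)
  have "\<forall>(n::nat) (ts::nat \<Rightarrow> real). 0 \<le> ts 0 \<and> (\<forall>i<n. ts i \<le> ts (Suc i)) \<longrightarrow>
      prob_space.indep_vars M (\<lambda>_. borel) (\<lambda>i \<omega>. B (ts (Suc i)) \<omega> - B (ts i) \<omega>) {..<n}"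
    using bm unfolding standard_brownian_motion_def by blast
  from this[rule_format, of "\<lambda>i. real i * h" n] mono
  have "prob_space.indep_vars M (\<lambda>_. borel)
      (\<lambda>i \<omega>. B (real (Suc i) * h) \<omega> - B (real i * h) \<omega>) {..<n}"
    by (simp del: of_nat_Suc)
  then show "prob_space.indep_vars M (\<lambda>_. borel) (\<lambda>i \<omega>. grid_increment (\<lambda>s. B s \<omega>) h i) {..<n}"
    unfolding grid_increment_def .
  have less: "0 \<le> real i * h" "real i * h < real (Suc i) * h" using h by auto
  have step: "real (Suc i) * h - real i * h = h" by (simp add: algebra_simps)
  have "distributed M lborel (\<lambda>\<omega>. B (real (Suc i) * h) \<omega> - B (real i * h) \<omega>)
      (\<lambda>x. ennreal (normal_density 0 (sqrt (real (Suc i) * h - real i * h)) x))"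
    using bm less unfolding standard_brownian_motion_def by blast
  then have "distr M lborel (\<lambda>\<omega>. grid_increment (\<lambda>s. B s \<omega>) h i) = normal_measure h"
    unfolding step grid_increment_def by (rule distributed_distr_eq_density)
  moreover have "distr M borel (\<lambda>\<omega>. grid_increment (\<lambda>s. B s \<omega>) h i)
      = distr M lborel (\<lambda>\<omega>. grid_increment (\<lambda>s. B s \<omega>) h i)"
    by (intro distr_cong refl) simp_all
  ultimately show "distr M borel (\<lambda>\<omega>. grid_increment (\<lambda>s. B s \<omega>) h i) = normal_measure h" by simp
qed

lemma grid_increment_measurable:
  assumes bm: "standard_brownian_motion M B" and h: "h \<ge> 0"
  shows "(\<lambda>\<omega>. grid_increment (\<lambda>s. B s \<omega>) h i) \<in> borel_measurable M"
proof -
  have "B u \<in> borel_measurable M" if "u \<ge> 0" for u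
    using bm that unfolding standard_brownian_motion_def by blast
  then show ?thesis
    unfolding grid_increment_def by (intro borel_measurable_diff) (use h in simp_all)
qed

lemma expsum_grid_measurable:
  assumes bm: "standard_brownian_motion M B" and h: "h \<ge> 0"
  shows "(\<lambda>\<omega>. expsum h (grid_increment (\<lambda>s. B s \<omega>) h) k) \<in> borel_measurable M"
proof -
  have [measurable]: "(\<lambda>\<omega>. walk (grid_increment (\<lambda>s. B s \<omega>) h) j) \<in> borel_measurable M" for j
    by (intro measurable_walk grid_increment_measurable[OF bm h])
  show ?thesis unfolding expsum_def by measurable
qed

lemma expsum_tendsto_expfun:
  assumes bm: "standard_brownian_motion M B" and s: "0 < s" "s \<le> t" and \<omega>: "\<omega> \<in> space M"
  shows "(\<lambda>n. expsum (t / real n) (grid_increment (\<lambda>s. B s \<omega>) (t / real n)) (grid_index t n s))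
     \<longlonglongrightarrow> expfun B s \<omega>"
proof -
  have "continuous_on {0..} (\<lambda>s. B s \<omega>)" "B 0 \<omega> = 0"
    using bm \<omega> unfolding standard_brownian_motion_def by auto
  then have "continuous_on {0..t} (\<lambda>s. B s \<omega>)" "B 0 \<omega> = 0"
    by (auto intro: continuous_on_subset)
  from expsum_tendsto_integral[OF this s] show ?thesis unfolding expfun_def .
qed

text \<open>The pathwise integral inherits measurability as a pointwise limit of the discrete sums,
  taken with t = s.\<close>

lemma expfun_measurable:
  assumes bm: "standard_brownian_motion M B" and s: "0 < s"
  shows "expfun B s \<in> borel_measurable M"
proof (rule borel_measurable_LIMSEQ_real)
  show "(\<lambda>n. expsum (s / real n) (grid_increment (\<lambda>s. B s \<omega>) (s / real n)) (grid_index s n s))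
      \<longlonglongrightarrow> expfun B s \<omega>" if "\<omega> \<in> space M" for \<omega>
    by (rule expsum_tendsto_expfun[OF bm s order_refl that])
  show "(\<lambda>\<omega>. expsum (s / real n) (grid_increment (\<lambda>s. B s \<omega>) (s / real n)) (grid_index s n s))
      \<in> borel_measurable M" for n
    using s by (intro expsum_grid_measurable[OF bm]) simp
qed

lemma expfun_pos:
  assumes bm: "standard_brownian_motion M B" and s: "0 < s" and \<omega>: "\<omega> \<in> space M"
  shows "expfun B s \<omega> > 0"
proof -
  have "continuous_on {0..} (\<lambda>s. B s \<omega>)"
    using bm \<omega> unfolding standard_brownian_motion_def by auto
  then have cont: "continuous_on {0..s} (\<lambda>u. exp (2 * B u \<omega>))"
    by (intro continuous_intros) (auto intro: continuous_on_subset)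
  have "integral {0..s} (\<lambda>u. exp (2 * B u \<omega>)) \<noteq> 0"
  proof
    assume "integral {0..s} (\<lambda>u. exp (2 * B u \<omega>)) = 0"
    then have "\<forall>u\<in>{0..s}. exp (2 * B u \<omega>) = 0"
      by (subst (asm) integral_eq_0_iff[OF cont s]) simp_all
    moreover have "0 \<in> {0..s}" using s by simp
    ultimately have "exp (2 * B 0 \<omega>) = 0" by blast
    then show False by simp
  qed
  moreover have "0 \<le> integral {0..s} (\<lambda>u. exp (2 * B u \<omega>))"
    by (intro Henstock_Kurzweil_Integration.integral_nonneg integrable_continuous_real cont) auto
  ultimately show ?thesis unfolding expfun_def by simp
qed

text \<open>At stage n both sides are expectations of one function \<open>H n\<close> of the ratio
  path and the end point, on the left with the end point negated. Their gap is controlled by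
  \<open>gaussian_walk_almost_symmetric\<close> with h = t / n, where n * h^2 = t^2 / n. Continuity
  and boundedness of the test functions turn the pathwise convergence of the sums into convergence
  of both expectations.\<close>

lemma expectation_prod_eq:
  fixes \<psi> :: "real \<Rightarrow> real \<Rightarrow> real"
  assumes bm: "standard_brownian_motion M B" and t: "t > 0"
    and J: "finite J" "J \<subseteq> {0<..t}"
    and \<psi>: "\<And>s. continuous_on UNIV (\<psi> s)" "\<And>s x. 0 \<le> \<psi> s x" "\<And>s x. \<psi> s x \<le> 1"
  shows "(\<integral>\<omega>. (\<Prod>s\<in>J. \<psi> s (1 / expfun B s \<omega> + exp (2 * B t \<omega>) / expfun B t \<omega> - 1 / expfun B t \<omega>)) \<partial>M)
       = (\<integral>\<omega>. (\<Prod>s\<in>J. \<psi> s (1 / expfun B s \<omega>)) \<partial>M)"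
proof -
  have M: "prob_space M" using bm by (simp add: standard_brownian_motion_def)
  interpret prob_space M by fact
  define D where "D n \<omega> = grid_increment (\<lambda>s. B s \<omega>) (t / real n)" for n \<omega>
  define A where "A n s \<omega> = expsum (t / real n) (D n \<omega>) (grid_index t n s)" for n s \<omega>
  define U where "U n \<omega> = (\<Prod>s\<in>J. \<psi> s (1 / A n s \<omega>))" for n \<omega>
  define V where "V n \<omega> = (\<Prod>s\<in>J. \<psi> s (1 / A n s \<omega> + exp (2 * B t \<omega>) / A n t \<omega> - 1 / A n t \<omega>))" for n \<omega>
  define H where "H n p = (\<Prod>s\<in>J. \<psi> s (recip (t / real n) n (grid_index t n s) p))" for n p
  have [measurable]: "\<psi> s \<in> borel_measurable borel" for s
    by (intro borel_measurable_continuous_onI \<psi>)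
  have [measurable]: "B t \<in> borel_measurable M"
    using bm t unfolding standard_brownian_motion_def by auto
  have [measurable]: "A n s \<in> borel_measurable M" for n s
    unfolding A_def[abs_def] D_def using t by (intro expsum_grid_measurable[OF bm]) simp
  have [measurable]: "expfun B s \<in> borel_measurable M" if "s \<in> J" for s
    using that J by (intro expfun_measurable[OF bm]) auto
  have [measurable]: "expfun B t \<in> borel_measurable M"
    by (rule expfun_measurable[OF bm t])
  have prod_bnd: "0 \<le> (\<Prod>s\<in>J. \<psi> s (f s))" "(\<Prod>s\<in>J. \<psi> s (f s)) \<le> 1" for f
    using \<psi> by (auto intro!: prod_nonneg prod_le_1)
  have A_lim: "(\<lambda>n. A n s \<omega>) \<longlonglongrightarrow> expfun B s \<omega>" if "s \<in> insert t J" "\<omega> \<in> space M" for s \<omega>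
    unfolding A_def D_def using that J t by (intro expsum_tendsto_expfun[OF bm]) auto
  have A_pos: "expfun B s \<omega> \<noteq> 0" if "s \<in> insert t J" "\<omega> \<in> space M" for s \<omega>
    using expfun_pos[OF bm _ that(2), of s] that J t by auto
  have \<psi>_lim: "(\<lambda>n. \<psi> s (f n)) \<longlonglongrightarrow> \<psi> s l" if "f \<longlonglongrightarrow> l" for s f l
    by (rule continuous_on_tendsto_compose[OF \<psi>(1) that]) auto
  have U_lim: "(\<lambda>n. \<integral>\<omega>. U n \<omega> \<partial>M) \<longlonglongrightarrow> (\<integral>\<omega>. (\<Prod>s\<in>J. \<psi> s (1 / expfun B s \<omega>)) \<partial>M)"
  proof (rule integral_dominated_convergence[where w = "\<lambda>_. 1"])
    show "AE \<omega> in M. (\<lambda>n. U n \<omega>) \<longlonglongrightarrow> (\<Prod>s\<in>J. \<psi> s (1 / expfun B s \<omega>))"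
      unfolding U_def
      by (intro AE_I2 tendsto_prod \<psi>_lim tendsto_divide tendsto_const A_lim A_pos) auto
  qed (use prod_bnd in \<open>auto simp: U_def abs_of_nonneg\<close>)
  have V_lim: "(\<lambda>n. \<integral>\<omega>. V n \<omega> \<partial>M) \<longlonglongrightarrow>
    (\<integral>\<omega>. (\<Prod>s\<in>J. \<psi> s (1 / expfun B s \<omega> + exp (2 * B t \<omega>) / expfun B t \<omega> - 1 / expfun B t \<omega>)) \<partial>M)"
  proof (rule integral_dominated_convergence[where w = "\<lambda>_. 1"])
    show "AE \<omega> in M. (\<lambda>n. V n \<omega>) \<longlonglongrightarrow>
        (\<Prod>s\<in>J. \<psi> s (1 / expfun B s \<omega> + exp (2 * B t \<omega>) / expfun B t \<omega> - 1 / expfun B t \<omega>))"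
      unfolding V_def
      by (intro AE_I2 tendsto_prod \<psi>_lim tendsto_divide tendsto_const tendsto_add tendsto_diff A_lim A_pos) auto
  qed (use prod_bnd in \<open>auto simp: V_def abs_of_nonneg\<close>)
  \<comment> \<open>The condition \<open>real n \<ge> 21 * t\<close> is h \<le> 1 / 21 for the mesh
    h = t / n.\<close>
  have close: "\<bar>(\<integral>\<omega>. V n \<omega> \<partial>M) - (\<integral>\<omega>. U n \<omega> \<partial>M)\<bar> \<le> sqrt (exp (420 * t\<^sup>2 / real n) - 1)"
    if n: "real n \<ge> 21 * t" "n > 0" for n
  proof -
    let ?h = "t / real n"
    have h: "0 < ?h" "?h \<le> 1 / 21" using t n by (auto simp: field_simps)
    have B0: "B 0 \<omega> = 0" if "\<omega> \<in> space M" for \<omega>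
      using bm that unfolding standard_brownian_motion_def by auto
    have walk_D: "walk (D n \<omega>) n = B t \<omega>" if "\<omega> \<in> space M" for \<omega>
      using walk_grid_increment[of "\<lambda>s. B s \<omega>", OF B0[OF that], of ?h n] n by (simp add: D_def)
    have A_t: "A n t \<omega> = expsum ?h (D n \<omega>) n" for \<omega>
      using t by (simp add: A_def grid_index_self)
    have idx: "1 \<le> grid_index t n s" "grid_index t n s \<le> n" if "s \<in> J" for s
      using grid_index_bounds[of s t n] that J n by auto
    have eqU: "H n (history ?h n (D n \<omega>), walk (D n \<omega>) n) = U n \<omega>" for \<omega>
      unfolding H_def U_def A_def using recip_history(1)[OF h(1) idx]
      by (intro prod.cong) auto
    have eqV: "H n (history ?h n (D n \<omega>), - walk (D n \<omega>) n) = V n \<omega>" if "\<omega> \<in> space M" for \<omega>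
    proof -
      have "recip ?h n (grid_index t n s) (history ?h n (D n \<omega>), - B t \<omega>)
        = 1 / A n s \<omega> + exp (2 * B t \<omega>) / A n t \<omega> - 1 / A n t \<omega>" if "s \<in> J" for s
        using recip_history(2)[OF h(1) idx[OF that], of "D n \<omega>"]
        unfolding A_t unfolding A_def walk_D[OF \<open>\<omega> \<in> space M\<close>] .
      then show ?thesis unfolding H_def V_def walk_D[OF that] by (intro prod.cong) auto
    qed
    have H_meas: "H n \<in> borel_measurable (Pi\<^sub>M UNIV (\<lambda>_. borel) \<Otimes>\<^sub>M borel)"
      unfolding H_def[abs_def] by measurable
    have H_bnd: "0 \<le> H n p" "H n p \<le> 1" for p
      unfolding H_def by (rule prod_bnd)+
    have intU: "(\<integral>\<omega>. H n (history ?h n (D n \<omega>), walk (D n \<omega>) n) \<partial>M) = (\<integral>\<omega>. U n \<omega> \<partial>M)"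
      by (simp only: eqU)
    have intV: "(\<integral>\<omega>. H n (history ?h n (D n \<omega>), - walk (D n \<omega>) n) \<partial>M) = (\<integral>\<omega>. V n \<omega> \<partial>M)"
      by (rule Bochner_Integration.integral_cong[OF refl eqV])
    have "420 * real n * ?h\<^sup>2 = 420 * t\<^sup>2 / real n"
      using n by (simp add: power2_eq_square)
    then show ?thesis
      using gaussian_walk_almost_symmetric[OF M h n(2) grid_increment_brownian(1)[OF bm h(1)]
        grid_increment_brownian(2)[OF bm h(1)] H_meas H_bnd, folded D_def]
      unfolding intU intV by (simp only:)
  qed
  have "(\<lambda>n. sqrt (exp (420 * t\<^sup>2 / real n) - 1)) \<longlonglongrightarrow> sqrt (exp 0 - 1)"
    by (intro tendsto_intros lim_const_over_n)
  then have "(\<lambda>n. sqrt (exp (420 * t\<^sup>2 / real n) - 1)) \<longlonglongrightarrow> 0" by simp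
  moreover obtain N :: nat where "21 * t < real N" using reals_Archimedean2 by blast
  then have "\<forall>\<^sub>F n in sequentially. norm ((\<integral>\<omega>. V n \<omega> \<partial>M) - (\<integral>\<omega>. U n \<omega> \<partial>M))
      \<le> sqrt (exp (420 * t\<^sup>2 / real n) - 1)"
    using close by (intro eventually_sequentiallyI[of "Suc N"]) auto
  ultimately have "(\<lambda>n. (\<integral>\<omega>. V n \<omega> \<partial>M) - (\<integral>\<omega>. U n \<omega> \<partial>M)) \<longlonglongrightarrow> 0"
    by (rule Lim_null_comparison[rotated])
  from LIMSEQ_unique[OF tendsto_diff[OF V_lim U_lim] this] show ?thesis by simp
qed

section \<open>Equality of process laws from finite-dimensional distribution functions\<close>

text \<open>Lower orthants in finitely many coordinates form a pi-system, with intersections given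
  by minima of thresholds. They generate the product sigma-algebra even for uncountable T, because
  that is generated by single coordinates. The case \<open>J = {}\<close> supplies the whole
  space.\<close>

lemma measure_eqI_PiM_borel_atMost:
  fixes M N :: "('i \<Rightarrow> real) measure"
  assumes M: "sets M = sets (Pi\<^sub>M T (\<lambda>_. borel))" and N: "sets N = sets (Pi\<^sub>M T (\<lambda>_. borel))"
    and fin: "finite_measure M"
    and eq: "\<And>J a. finite J \<Longrightarrow> J \<subseteq> T \<Longrightarrow>
      emeasure M {f \<in> T \<rightarrow>\<^sub>E UNIV. \<forall>s\<in>J. f s \<le> a s} = emeasure N {f \<in> T \<rightarrow>\<^sub>E UNIV. \<forall>s\<in>J. f s \<le> a s}"
  shows "M = N"
proof -
  let ?\<Omega> = "T \<rightarrow>\<^sub>E (UNIV :: real set)"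
  define E where "E = {{f \<in> ?\<Omega>. \<forall>s\<in>J. f s \<le> a s} | J (a :: 'i \<Rightarrow> real). finite J \<and> J \<subseteq> T}"
  have E_Pow: "E \<subseteq> Pow ?\<Omega>" by (auto simp: E_def)
  have E_I: "{f \<in> ?\<Omega>. \<forall>s\<in>J. f s \<le> a s} \<in> E" if "finite J" "J \<subseteq> T" for J a
    using that unfolding E_def by blast
  have sets_E: "sets (Pi\<^sub>M T (\<lambda>_. borel)) = sigma_sets ?\<Omega> E"
  proof (rule antisym)
    show "sets (Pi\<^sub>M T (\<lambda>_. borel)) \<subseteq> sigma_sets ?\<Omega> E"
      unfolding sets_PiM_single space_borel
    proof (rule sigma_sets_mono, safe)
      fix i and A :: "real set" assume i: "i \<in> T" and A: "A \<in> sets borel"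
      have "(\<lambda>f. f i) \<in> borel_measurable (sigma ?\<Omega> E)"
      proof (rule borel_measurableI_le)
        fix y :: real
        have "{f \<in> ?\<Omega>. \<forall>s\<in>{i}. f s \<le> y} \<in> E" using i by (intro E_I) auto
        then show "{f \<in> space (sigma ?\<Omega> E). f i \<le> y} \<in> sets (sigma ?\<Omega> E)"
          using E_Pow by (auto simp: space_measure_of sets_measure_of)
      qed
      from measurable_sets[OF this A] show "{f \<in> ?\<Omega>. f i \<in> A} \<in> sigma_sets ?\<Omega> E"
        using E_Pow by (simp add: space_measure_of sets_measure_of vimage_def Int_def conj_commute)
    qed
    have "X \<in> sets (Pi\<^sub>M T (\<lambda>_. borel))" if "X \<in> E" for X
    proof -
      obtain J a where J: "finite J" "J \<subseteq> T" "X = {f \<in> ?\<Omega>. \<forall>s\<in>J. f s \<le> a s}"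
        using \<open>X \<in> E\<close> unfolding E_def by blast
      have "Measurable.pred (Pi\<^sub>M T (\<lambda>_. borel)) (\<lambda>f. \<forall>s\<in>J. f s \<le> a s)"
      proof (rule pred_intros_finite(3)[OF J(1)])
        fix s assume "s \<in> J"
        then have [measurable]: "(\<lambda>f. f s) \<in> borel_measurable (Pi\<^sub>M T (\<lambda>_. borel :: real measure))"
          using J by (intro measurable_component_singleton) auto
        show "Measurable.pred (Pi\<^sub>M T (\<lambda>_. borel)) (\<lambda>f. f s \<le> a s)" by measurable
      qed
      then show ?thesis unfolding J(3) by (simp add: pred_def space_PiM)
    qed
    then show "sigma_sets ?\<Omega> E \<subseteq> sets (Pi\<^sub>M T (\<lambda>_. borel))"
      using sets.sigma_sets_subset[of E "Pi\<^sub>M T (\<lambda>_. borel)"] by (auto simp: space_PiM)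
  qed
  show ?thesis
  proof (rule measure_eqI_generator_eq[where E = E and \<Omega> = ?\<Omega> and A = "\<lambda>_. ?\<Omega>"])
    show "Int_stable E"
    proof (rule Int_stableI)
      fix X Y assume "X \<in> E" "Y \<in> E"
      then obtain J a K c where X: "finite J" "J \<subseteq> T" "X = {f \<in> ?\<Omega>. \<forall>s\<in>J. f s \<le> a s}"
        and Y: "finite K" "K \<subseteq> T" "Y = {f \<in> ?\<Omega>. \<forall>s\<in>K. f s \<le> c s}"
        unfolding E_def by blast
      define d where "d s = (if s \<in> J \<and> s \<in> K then min (a s) (c s) else if s \<in> J then a s else c s)" for s
      have "X \<inter> Y = {f \<in> ?\<Omega>. \<forall>s\<in>J \<union> K. f s \<le> d s}"
      proof (intro set_eqI iffI)
        fix f assume "f \<in> X \<inter> Y"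
        then show "f \<in> {f \<in> ?\<Omega>. \<forall>s\<in>J \<union> K. f s \<le> d s}"
          unfolding X Y by (auto simp: d_def)
      next
        fix f assume f: "f \<in> {f \<in> ?\<Omega>. \<forall>s\<in>J \<union> K. f s \<le> d s}"
        have "d s \<le> a s" if "s \<in> J" for s using that by (simp add: d_def)
        moreover have "d s \<le> c s" if "s \<in> K" for s using that by (simp add: d_def)
        ultimately show "f \<in> X \<inter> Y"
          using f unfolding X Y by (auto intro: order_trans)
      qed
      also have "\<dots> \<in> E" using X Y by (intro E_I) auto
      finally show "X \<inter> Y \<in> E" .
    qed
    show "emeasure M X = emeasure N X" if "X \<in> E" for X
      using that eq unfolding E_def by blast
    show "range (\<lambda>_. ?\<Omega>) \<subseteq> E" using E_I[of "{}"] by auto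
    show "emeasure M ?\<Omega> \<noteq> \<infinity>" using finite_measure.emeasure_finite[OF fin] by simp
  qed (use E_Pow M N sets_E in auto)
qed

text \<open>Continuous functions with values in [0, 1] that approximate the indicator of {..a} from
  above. The value 1 at x = a itself makes the limit the closed half-line, as distribution functions
  need.\<close>

definition ramp :: "nat \<Rightarrow> real \<Rightarrow> real \<Rightarrow> real" where
  "ramp m a x = max 0 (min 1 (1 - real m * (x - a)))"

lemma ramp_tendsto: "(\<lambda>m. ramp m a x) \<longlonglongrightarrow> (if x \<le> a then 1 else 0)"
proof (cases "x \<le> a")
  case True
  then have "real m * (x - a) \<le> 0" for m by (simp add: mult_nonneg_nonpos)
  then have "ramp m a x = 1" for m by (simp add: ramp_def)
  with True show ?thesis by simp
next
  case False
  obtain N :: nat where N: "1 / (x - a) < real N" using reals_Archimedean2 by blast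
  have "ramp m a x = 0" if "m \<ge> N" for m
  proof -
    have "1 / (x - a) \<le> real m" using N that by simp
    then have "1 \<le> real m * (x - a)" using False by (simp add: divide_le_eq)
    then show ?thesis by (simp add: ramp_def)
  qed
  then have "\<forall>\<^sub>F m in sequentially. ramp m a x = 0" by (auto simp: eventually_sequentially)
  with False show ?thesis by (simp add: tendsto_eventually)
qed

lemma (in prob_space) expectation_ramp_tendsto:
  fixes X :: "real \<Rightarrow> 'a \<Rightarrow> real"
  assumes J: "finite J" and X [measurable]: "\<And>s. s \<in> J \<Longrightarrow> X s \<in> borel_measurable M"
  shows "(\<lambda>m. \<integral>\<omega>. (\<Prod>s\<in>J. ramp m (a s) (X s \<omega>)) \<partial>M) \<longlonglongrightarrow> prob {\<omega> \<in> space M. \<forall>s\<in>J. X s \<omega> \<le> a s}"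
proof -
  let ?S = "{\<omega> \<in> space M. \<forall>s\<in>J. X s \<omega> \<le> a s}"
  have S: "?S \<in> events" using J by measurable
  have ramp_bnd: "0 \<le> ramp m b x" "ramp m b x \<le> 1" for m b x by (auto simp: ramp_def)
  have [measurable]: "ramp m b \<in> borel_measurable borel" for m b
    unfolding ramp_def[abs_def] by measurable
  have "(\<lambda>m. \<integral>\<omega>. (\<Prod>s\<in>J. ramp m (a s) (X s \<omega>)) \<partial>M) \<longlonglongrightarrow> (\<integral>\<omega>. indicator ?S \<omega> \<partial>M)"
  proof (rule integral_dominated_convergence[where w = "\<lambda>_. 1"])
    show "AE \<omega> in M. (\<lambda>m. \<Prod>s\<in>J. ramp m (a s) (X s \<omega>)) \<longlonglongrightarrow> (indicator ?S \<omega> :: real)"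
    proof (rule AE_I2)
      fix \<omega> assume \<omega>: "\<omega> \<in> space M"
      have "(\<lambda>m. \<Prod>s\<in>J. ramp m (a s) (X s \<omega>)) \<longlonglongrightarrow> (\<Prod>s\<in>J. if X s \<omega> \<le> a s then 1 else 0)"
        by (intro tendsto_prod ramp_tendsto)
      also have "(\<Prod>s\<in>J. if X s \<omega> \<le> a s then 1 else 0) = (indicator ?S \<omega> :: real)"
        using \<omega> J by (auto simp: indicator_def prod_zero_iff)
      finally show "(\<lambda>m. \<Prod>s\<in>J. ramp m (a s) (X s \<omega>)) \<longlonglongrightarrow> (indicator ?S \<omega> :: real)" .
    qed
    show "AE \<omega> in M. norm (\<Prod>s\<in>J. ramp m (a s) (X s \<omega>)) \<le> 1" for m
      using ramp_bnd by (auto simp: abs_of_nonneg prod_nonneg intro!: prod_le_1)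
  qed (use S in auto)
  then show ?thesis using S by simp
qed

theorem theorem1:
  fixes M :: "'a measure" and B :: "real \<Rightarrow> 'a \<Rightarrow> real" and t :: real
  assumes "standard_brownian_motion M B" and "t > 0"
  shows "process_law M {0<..t}
           (\<lambda>s \<omega>. 1 / expfun B s \<omega> + exp (2 * B t \<omega>) / expfun B t \<omega> - 1 / expfun B t \<omega>)
         = process_law M {0<..t} (\<lambda>s \<omega>. 1 / expfun B s \<omega>)"
    (is "process_law M ?T ?X = process_law M ?T ?Y")
proof -
  interpret prob_space M using assms by (simp add: standard_brownian_motion_def)
  have [measurable]: "B t \<in> borel_measurable M"
    using assms unfolding standard_brownian_motion_def by simp
  have [measurable]: "expfun B s \<in> borel_measurable M" if "s \<in> ?T" for s
    using that by (intro expfun_measurable[OF assms(1)]) simp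
  have [measurable]: "expfun B t \<in> borel_measurable M"
    by (rule expfun_measurable[OF assms])
  have meas: "?X s \<in> borel_measurable M" "?Y s \<in> borel_measurable M" if "s \<in> ?T" for s
    using that by measurable
  have law: "emeasure (process_law M ?T Z) {f \<in> ?T \<rightarrow>\<^sub>E UNIV. \<forall>s\<in>J. f s \<le> a s}
      = prob {\<omega> \<in> space M. \<forall>s\<in>J. Z s \<omega> \<le> a s}"
    if Z: "\<And>s. s \<in> ?T \<Longrightarrow> Z s \<in> borel_measurable M" and J: "finite J" "J \<subseteq> ?T" for Z J a
  proof -
    have map: "(\<lambda>\<omega>. \<lambda>s\<in>?T. Z s \<omega>) \<in> measurable M (Pi\<^sub>M ?T (\<lambda>_. borel))"
      by (intro measurable_restrict Z)
    have "Measurable.pred (Pi\<^sub>M ?T (\<lambda>_. borel)) (\<lambda>f. \<forall>s\<in>J. f s \<le> a s)"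
    proof (rule pred_intros_finite(3)[OF J(1)])
      fix s assume "s \<in> J"
      then have [measurable]: "(\<lambda>f. f s) \<in> borel_measurable (Pi\<^sub>M ?T (\<lambda>_. borel :: real measure))"
        using J by (intro measurable_component_singleton) auto
      show "Measurable.pred (Pi\<^sub>M ?T (\<lambda>_. borel)) (\<lambda>f. f s \<le> a s)" by measurable
    qed
    then have "{f \<in> ?T \<rightarrow>\<^sub>E UNIV. \<forall>s\<in>J. f s \<le> a s} \<in> sets (Pi\<^sub>M ?T (\<lambda>_. borel))"
      by (simp add: pred_def space_PiM)
    then have "emeasure (process_law M ?T Z) {f \<in> ?T \<rightarrow>\<^sub>E UNIV. \<forall>s\<in>J. f s \<le> a s}
       = emeasure M ((\<lambda>\<omega>. \<lambda>s\<in>?T. Z s \<omega>) -` {f \<in> ?T \<rightarrow>\<^sub>E UNIV. \<forall>s\<in>J. f s \<le> a s} \<inter> space M)"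
      unfolding process_law_def by (rule emeasure_distr[OF map])
    also have "(\<lambda>\<omega>. \<lambda>s\<in>?T. Z s \<omega>) -` {f \<in> ?T \<rightarrow>\<^sub>E UNIV. \<forall>s\<in>J. f s \<le> a s} \<inter> space M
       = {\<omega> \<in> space M. \<forall>s\<in>J. Z s \<omega> \<le> a s}"
      using J by (auto simp: subset_iff)
    finally show ?thesis by (simp add: emeasure_eq_measure)
  qed
  \<comment> \<open>Indicators of orthants are not continuous, so \<open>expectation_prod_eq\<close>
    is applied to ramps at the thresholds, and their slope is then sent to infinity on both
    sides.\<close>
  have probs: "prob {\<omega> \<in> space M. \<forall>s\<in>J. ?X s \<omega> \<le> a s} = prob {\<omega> \<in> space M. \<forall>s\<in>J. ?Y s \<omega> \<le> a s}"
    if J: "finite J" "J \<subseteq> ?T" for J a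
  proof -
    have "(\<integral>\<omega>. (\<Prod>s\<in>J. ramp m (a s) (?X s \<omega>)) \<partial>M) = (\<integral>\<omega>. (\<Prod>s\<in>J. ramp m (a s) (?Y s \<omega>)) \<partial>M)" for m
      by (rule expectation_prod_eq[OF assms J])
        (auto simp: ramp_def intro!: continuous_intros)
    moreover have "(\<lambda>m. \<integral>\<omega>. (\<Prod>s\<in>J. ramp m (a s) (?X s \<omega>)) \<partial>M)
        \<longlonglongrightarrow> prob {\<omega> \<in> space M. \<forall>s\<in>J. ?X s \<omega> \<le> a s}"
      using J meas(1) by (intro expectation_ramp_tendsto) blast+
    moreover have "(\<lambda>m. \<integral>\<omega>. (\<Prod>s\<in>J. ramp m (a s) (?Y s \<omega>)) \<partial>M)
        \<longlonglongrightarrow> prob {\<omega> \<in> space M. \<forall>s\<in>J. ?Y s \<omega> \<le> a s}"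
      using J meas(2) by (intro expectation_ramp_tendsto) blast+
    ultimately show ?thesis using LIMSEQ_unique by simp
  qed
  show ?thesis
  proof (rule measure_eqI_PiM_borel_atMost[where T = ?T])
    show "finite_measure (process_law M ?T ?X)"
      unfolding process_law_def
      by (intro prob_space.finite_measure prob_space_distr measurable_restrict meas)
    show "emeasure (process_law M ?T ?X) {f \<in> ?T \<rightarrow>\<^sub>E UNIV. \<forall>s\<in>J. f s \<le> a s}
      = emeasure (process_law M ?T ?Y) {f \<in> ?T \<rightarrow>\<^sub>E UNIV. \<forall>s\<in>J. f s \<le> a s}"
      if J: "finite J" "J \<subseteq> ?T" for J a
      using law[of ?X J a, OF meas(1) J] law[of ?Y J a, OF meas(2) J] probs[OF J, of a]
      by (simp only:)
  qed (simp_all add: process_law_def)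
qed

end
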